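(* Let $\mu>-\tfrac12$. The generalized Fourier transform $\mathcal F_\mu$ is a unitary transformation on $L^2_\mu(\mathbb R)$ with eigenvalues $1,-1,i,-i$. The set $\{\phi_n^\mu\}_{n\in\mathbb N}$ is a complete orthonormal set of eigenvectors of $\mathcal F_\mu$ in $L^2_\mu(\mathbb R)$. The inverse Fourier transform is given by $$\mathcal F_\mu^*f(x)=\left(2^{\mu+\frac12}\Gamma(\mu+\tfrac12)\right)^{-1}\int_{-\infty}^\infty\boldsymbol e_\mu(ixt)f(t)|t|^{2\mu}\,dt,\qquad f\in\mathfrak S.$$
   Context: $\mathbb N=\{0,1,2,\dots\}$. $L^2_\mu(\mathbb R)$ is the Hilbert space of Lebesgue measurable $f$ on $\mathbb R$ with $\|f\|_\mu^2=\int_{-\infty}^\infty|f(t)|^2|t|^{2\mu}\,dt<\infty$. For $m\in\mathbb N$: $\gamma_\mu(2m)=\frac{2^{2m}m!\,\Gamma(m+\mu+\frac12)}{\Gamma(\mu+\frac12)}$, $\gamma_\mu(2m+1)=\frac{2^{2m+1}m!\,\Gamma(m+\mu+\frac32)}{\Gamma(\mu+\frac12)}$; $\boldsymbol e_\mu(x)=\sum_{m=0}^\infty x^m/\gamma_\mu(m)$ (entire). Generalized Hermite polynomials: $H_n^\mu(x)=n!\sum_{k=0}^{\lfloor n/2\rfloor}\frac{(-1)^k(2x)^{n-2k}}{k!\,\gamma_\mu(n-2k)}$. Generalized Hermite functions: $\phi_n^\mu(x)=\left(\frac{\gamma_\mu(n)}{\Gamma(\mu+\frac12)}\right)^{1/2}\frac{1}{2^{n/2}n!}e^{-x^2/2}H_n^\mu(x)$.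 $\mathfrak S$ is the linear span of $\{\phi_n^\mu:n\in\mathbb N\}$, equivalently of $\{e^{-x^2/2}x^n:n\in\mathbb N\}$. The generalized Fourier transform is defined on $\mathfrak S$ by $\mathcal F_\mu f(x)=\left(2^{\mu+\frac12}\Gamma(\mu+\frac12)\right)^{-1}\int_{-\infty}^\infty\boldsymbol e_\mu(-ixt)f(t)|t|^{2\mu}\,dt$; on $L^2_\mu(\mathbb R)$, $\mathcal F_\mu$ denotes its continuous extension. *)

theory Defs
  imports "HOL-Analysis.Analysis"
begin

section \<open>Functions modulo equality almost everywhere\<close>

text \<open>
  The null sets of the measure with density \<open>\<bar>t\<bar>\<^sup>2\<^sup>\<mu>\<close> are the Lebesgue null sets, so one quotient serves
  all values of \<open>\<mu>\<close>. Measurability is required only of the elements of the L2 space below.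
\<close>

definition ae_eq :: "(real \<Rightarrow> complex) \<Rightarrow> (real \<Rightarrow> complex) \<Rightarrow> bool" where
  "ae_eq f g \<longleftrightarrow> (AE t in lebesgue. f t = g t)"

quotient_type aefun = "real \<Rightarrow> complex" / ae_eq
proof (rule equivpI)
  show "reflp ae_eq"
    by (auto simp: reflp_def ae_eq_def)
  show "symp ae_eq"
    by (auto simp: symp_def ae_eq_def eq_commute)
  show "transp ae_eq"
    unfolding transp_def ae_eq_def by (auto elim: eventually_elim2)
qed

instantiation aefun :: ab_group_add
begin

lift_definition zero_aefun :: aefun is "\<lambda>t. 0" .

lift_definition plus_aefun :: "aefun \<Rightarrow> aefun \<Rightarrow> aefun" is "\<lambda>f g t. f t + g t"
  unfolding ae_eq_def by (erule (1) eventually_elim2) simp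

lift_definition uminus_aefun :: "aefun \<Rightarrow> aefun" is "\<lambda>f t. - f t"
  unfolding ae_eq_def by (erule eventually_mono) simp

lift_definition minus_aefun :: "aefun \<Rightarrow> aefun \<Rightarrow> aefun" is "\<lambda>f g t. f t - g t"
  unfolding ae_eq_def by (erule (1) eventually_elim2) simp

instance
  by standard (transfer; simp add: ae_eq_def algebra_simps)+

end

lift_definition scale_aefun :: "complex \<Rightarrow> aefun \<Rightarrow> aefun" is "\<lambda>c f t. c * f t"
  unfolding ae_eq_def by (erule eventually_mono) simp

global_interpretation aefun: vector_space scale_aefun
  by standard (transfer; simp add: ae_eq_def algebra_simps)+

lemma borel_measurable_lebesgue_cong_AE:
  fixes f g :: "real \<Rightarrow> 'b::topological_space"
  assumes f: "f \<in> borel_measurable lebesgue" and ae: "AE t in lebesgue. f t = g t"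
  shows "g \<in> borel_measurable lebesgue"
proof (rule measurableI)
  fix A :: "'b set" assume A: "A \<in> sets borel"
  obtain N where N: "{t. f t \<noteq> g t} \<subseteq> N" "N \<in> null_sets lebesgue"
    using ae by (auto simp: eventually_ae_filter)
  have "f -` A \<in> sets lebesgue"
    using measurable_sets[OF f A] by simp
  moreover have "N \<in> sets lebesgue" "g -` A \<inter> N \<in> sets lebesgue"
    using N(2) completion.complete2[of "g -` A \<inter> N" N lborel] by auto
  ultimately have "(f -` A - N) \<union> (g -` A \<inter> N) \<in> sets lebesgue"
    by blast
  moreover have "g -` A = (f -` A - N) \<union> (g -` A \<inter> N)"
  proof -
    have "f t = g t" if "t \<notin> N" for t
      using N(1) that by auto
    then show ?thesis by auto
  qed
  ultimately show "g -` A \<inter> space lebesgue \<in> sets lebesgue"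
    by simp
qed simp

lemma integrable_lebesgue_cong_AE:
  fixes f g :: "real \<Rightarrow> 'b::{banach, second_countable_topology}"
  assumes "AE t in lebesgue. f t = g t"
  shows "integrable lebesgue f \<longleftrightarrow> integrable lebesgue g"
proof -
  have "AE t in lebesgue. g t = f t"
    using assms by eventually_elim simp
  then show ?thesis
    by (metis assms borel_measurable_integrable borel_measurable_lebesgue_cong_AE integrable_cong_AE)
qed

lemma integral_lebesgue_cong_AE:
  fixes f g :: "real \<Rightarrow> 'b::{banach, second_countable_topology}"
  assumes "AE t in lebesgue. f t = g t"
  shows "integral\<^sup>L lebesgue f = integral\<^sup>L lebesgue g"
proof (cases "integrable lebesgue f")
  case True
  then have "integrable lebesgue g"
    using integrable_lebesgue_cong_AE[OF assms] by simp
  with True assms show ?thesis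
    by (intro integral_cong_AE) auto
next
  case False
  with integrable_lebesgue_cong_AE[OF assms] show ?thesis
    by (simp add: not_integrable_integral_eq)
qed

section \<open>The Hilbert space \<open>L\<^sup>2\<^sub>\<mu>(\<real>)\<close>\<close>

definition L2_fun :: "real \<Rightarrow> (real \<Rightarrow> complex) set" where
  "L2_fun \<mu> = {f \<in> borel_measurable lebesgue.
     integrable lebesgue (\<lambda>t. (cmod (f t))\<^sup>2 * \<bar>t\<bar> powr (2 * \<mu>))}"

definition L2 :: "real \<Rightarrow> aefun set" where
  "L2 \<mu> = abs_aefun ` L2_fun \<mu>"

lift_definition L2_inner :: "real \<Rightarrow> aefun \<Rightarrow> aefun \<Rightarrow> complex" is
  "\<lambda>\<mu> f g. LINT t|lebesgue. f t * cnj (g t) * complex_of_real (\<bar>t\<bar> powr (2 * \<mu>))"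
  unfolding ae_eq_def
  by (rule integral_lebesgue_cong_AE, erule (1) eventually_elim2) simp

lift_definition L2_norm :: "real \<Rightarrow> aefun \<Rightarrow> real" is
  "\<lambda>\<mu> f. sqrt (LINT t|lebesgue. (cmod (f t))\<^sup>2 * \<bar>t\<bar> powr (2 * \<mu>))"
  unfolding ae_eq_def
  by (intro arg_cong[where f = sqrt] integral_lebesgue_cong_AE, erule eventually_mono) simp

definition L2_topology :: "real \<Rightarrow> aefun topology" where
  "L2_topology \<mu> = Metric_space.mtopology (L2 \<mu>) (\<lambda>X Y. L2_norm \<mu> (X - Y))"

lemma abs_aefun_eq_iff: "abs_aefun f = abs_aefun g \<longleftrightarrow> (AE t in lebesgue. f t = g t)"
  by (simp add: aefun.abs_eq_iff ae_eq_def)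

lemma abs_aefun_in_L2_iff: "abs_aefun f \<in> L2 \<mu> \<longleftrightarrow> f \<in> L2_fun \<mu>"
proof
  assume "abs_aefun f \<in> L2 \<mu>"
  then obtain g where g: "g \<in> L2_fun \<mu>" and ae: "AE t in lebesgue. g t = f t"
    unfolding L2_def by (metis abs_aefun_eq_iff imageE)
  have "AE t in lebesgue. (cmod (g t))\<^sup>2 * \<bar>t\<bar> powr (2 * \<mu>) = (cmod (f t))\<^sup>2 * \<bar>t\<bar> powr (2 * \<mu>)"
    using ae by eventually_elim simp
  from integrable_lebesgue_cong_AE[OF this] g borel_measurable_lebesgue_cong_AE[OF _ ae]
  show "f \<in> L2_fun \<mu>"
    by (simp add: L2_fun_def)
qed (simp add: L2_def)

lemma L2_fun_add:
  assumes f: "f \<in> L2_fun \<mu>" and g: "g \<in> L2_fun \<mu>"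
  shows "(\<lambda>t. f t + g t) \<in> L2_fun \<mu>"
proof -
  let ?w = "\<lambda>t::real. \<bar>t\<bar> powr (2 * \<mu>)"
  have m: "f \<in> borel_measurable lebesgue" "g \<in> borel_measurable lebesgue"
    using f g by (auto simp: L2_fun_def)
  have w: "?w \<in> borel_measurable lebesgue"
    by (rule measurable_completion) measurable
  have "integrable lebesgue (\<lambda>t. 2 * ((cmod (f t))\<^sup>2 * ?w t) + 2 * ((cmod (g t))\<^sup>2 * ?w t))"
    using f g by (auto simp: L2_fun_def)
  moreover have "(cmod (f t + g t))\<^sup>2 * ?w t
      \<le> 2 * ((cmod (f t))\<^sup>2 * ?w t) + 2 * ((cmod (g t))\<^sup>2 * ?w t)" for t
  proof -
    have "(cmod (f t + g t))\<^sup>2 \<le> (cmod (f t) + cmod (g t))\<^sup>2"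
      by (intro power_mono norm_triangle_ineq) simp
    also have "\<dots> \<le> 2 * (cmod (f t))\<^sup>2 + 2 * (cmod (g t))\<^sup>2"
      using sum_squares_bound[of "cmod (f t)" "cmod (g t)"] by (simp add: power2_sum)
    finally have "(cmod (f t + g t))\<^sup>2 * ?w t \<le> (2 * (cmod (f t))\<^sup>2 + 2 * (cmod (g t))\<^sup>2) * ?w t"
      by (rule mult_right_mono) simp
    then show ?thesis by (simp add: algebra_simps)
  qed
  moreover have "(\<lambda>t. (cmod (f t + g t))\<^sup>2 * ?w t) \<in> borel_measurable lebesgue"
    using m w by measurable
  ultimately have "integrable lebesgue (\<lambda>t. (cmod (f t + g t))\<^sup>2 * ?w t)"
    by (elim Bochner_Integration.integrable_bound) (auto intro!: AE_I2)
  then show ?thesis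
    using m by (auto simp: L2_fun_def)
qed

lemma L2_fun_scale: "f \<in> L2_fun \<mu> \<Longrightarrow> (\<lambda>t. c * f t) \<in> L2_fun \<mu>"
  by (auto simp: L2_fun_def norm_mult power_mult_distrib mult.assoc)

lemma L2_subspace: "aefun.subspace (L2 \<mu>)"
proof (rule aefun.subspaceI)
  show "0 \<in> L2 \<mu>"
    unfolding zero_aefun.abs_eq abs_aefun_in_L2_iff by (simp add: L2_fun_def)
  show "X + Y \<in> L2 \<mu>" if "X \<in> L2 \<mu>" "Y \<in> L2 \<mu>" for X Y
    using that by (auto simp: L2_def plus_aefun.abs_eq intro!: imageI L2_fun_add)
  show "scale_aefun c X \<in> L2 \<mu>" if "X \<in> L2 \<mu>" for c X
    using that by (auto simp: L2_def scale_aefun.abs_eq intro!: imageI L2_fun_scale)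
qed

lemma L2_norm_add_le:
  assumes "X \<in> L2 \<mu>" "Y \<in> L2 \<mu>"
  shows "L2_norm \<mu> (X + Y) \<le> L2_norm \<mu> X + L2_norm \<mu> Y"
proof (rule field_le_epsilon)
  fix e :: real assume e: "e > 0"
  let ?w = "\<lambda>t::real. \<bar>t\<bar> powr (2 * \<mu>)"
  obtain f g where X: "X = abs_aefun f" and f: "f \<in> L2_fun \<mu>"
    and Y: "Y = abs_aefun g" and g: "g \<in> L2_fun \<mu>"
    using assms by (auto simp: L2_def)
  define a where "a = L2_norm \<mu> X + e / 2"
  define b where "b = L2_norm \<mu> Y + e / 2"
  let ?F = "\<lambda>t. (cmod (f t))\<^sup>2 * ?w t" and ?G = "\<lambda>t. (cmod (g t))\<^sup>2 * ?w t"
  have nX: "0 \<le> L2_norm \<mu> X" and nY: "0 \<le> L2_norm \<mu> Y"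
    by (simp_all add: X Y L2_norm.abs_eq integral_nonneg_AE)
  then have a: "a > 0" and b: "b > 0"
    using e by (auto simp: a_def b_def)
  have F: "(LINT t|lebesgue. ?F t) \<le> a\<^sup>2"
  proof -
    have "(LINT t|lebesgue. ?F t) = (L2_norm \<mu> X)\<^sup>2"
      by (simp add: X L2_norm.abs_eq integral_nonneg_AE)
    also have "\<dots> \<le> a\<^sup>2" using nX e by (intro power_mono) (auto simp: a_def)
    finally show ?thesis .
  qed
  have G: "(LINT t|lebesgue. ?G t) \<le> b\<^sup>2"
  proof -
    have "(LINT t|lebesgue. ?G t) = (L2_norm \<mu> Y)\<^sup>2"
      by (simp add: Y L2_norm.abs_eq integral_nonneg_AE)
    also have "\<dots> \<le> b\<^sup>2" using nY e by (intro power_mono) (auto simp: b_def)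
    finally show ?thesis .
  qed
  have pt: "(cmod (f t + g t))\<^sup>2 * ?w t \<le> (1 + b / a) * ?F t + (1 + a / b) * ?G t" for t
  proof -
    have "(cmod (f t + g t))\<^sup>2 \<le> (cmod (f t) + cmod (g t))\<^sup>2"
      by (intro power_mono norm_triangle_ineq) simp
    also have "\<dots> \<le> (1 + b / a) * (cmod (f t))\<^sup>2 + (1 + a / b) * (cmod (g t))\<^sup>2"
    proof -
      have "0 \<le> (b * cmod (f t) - a * cmod (g t))\<^sup>2 / (a * b)"
        using a b by simp
      also have "\<dots> = b / a * (cmod (f t))\<^sup>2 + a / b * (cmod (g t))\<^sup>2 - 2 * cmod (f t) * cmod (g t)"
        using a b by (simp add: field_simps power2_eq_square)
      finally show ?thesis by (simp add: power2_sum algebra_simps)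
    qed
    finally have "(cmod (f t + g t))\<^sup>2 * ?w t
        \<le> ((1 + b / a) * (cmod (f t))\<^sup>2 + (1 + a / b) * (cmod (g t))\<^sup>2) * ?w t"
      by (rule mult_right_mono) simp
    then show ?thesis by (simp add: algebra_simps)
  qed
  have "(LINT t|lebesgue. (cmod (f t + g t))\<^sup>2 * ?w t)
      \<le> (LINT t|lebesgue. (1 + b / a) * ?F t + (1 + a / b) * ?G t)"
    using f g L2_fun_add[OF f g] pt
    by (intro integral_mono) (auto simp: L2_fun_def)
  also have "\<dots> = (1 + b / a) * (LINT t|lebesgue. ?F t) + (1 + a / b) * (LINT t|lebesgue. ?G t)"
    using f g by (subst Bochner_Integration.integral_add) (auto simp: L2_fun_def)
  also have "\<dots> \<le> (1 + b / a) * a\<^sup>2 + (1 + a / b) * b\<^sup>2"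
    using a b F G by (intro add_mono mult_left_mono) auto
  also have "\<dots> = (a + b)\<^sup>2"
    using a b by (simp add: field_simps power2_eq_square)
  finally have "L2_norm \<mu> (X + Y) \<le> a + b"
    using a b by (simp add: X Y plus_aefun.abs_eq L2_norm.abs_eq real_le_lsqrt integral_nonneg_AE)
  then show "L2_norm \<mu> (X + Y) \<le> L2_norm \<mu> X + L2_norm \<mu> Y + e"
    by (simp add: a_def b_def)
qed

lemma L2_norm_nonneg: "0 \<le> L2_norm \<mu> X"
  by (transfer, simp add: integral_nonneg_AE)

lemma L2_norm_eq_0_iff:
  assumes "X \<in> L2 \<mu>"
  shows "L2_norm \<mu> X = 0 \<longleftrightarrow> X = 0"
proof -
  obtain f where X: "X = abs_aefun f" and f: "f \<in> L2_fun \<mu>"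
    using assms by (auto simp: L2_def)
  have ae0: "AE t in lebesgue. t \<noteq> (0::real)"
    by (rule AE_completion) (rule AE_lborel_singleton)
  have "L2_norm \<mu> X = 0 \<longleftrightarrow> (AE t in lebesgue. (cmod (f t))\<^sup>2 * \<bar>t\<bar> powr (2 * \<mu>) = 0)"
    using f by (simp add: X L2_norm.abs_eq L2_fun_def integral_nonneg_eq_0_iff_AE)
  also have "\<dots> \<longleftrightarrow> (AE t in lebesgue. f t = 0)"
  proof
    assume "AE t in lebesgue. (cmod (f t))\<^sup>2 * \<bar>t\<bar> powr (2 * \<mu>) = 0"
    with ae0 show "AE t in lebesgue. f t = 0" by eventually_elim auto
  next
    assume "AE t in lebesgue. f t = 0"
    then show "AE t in lebesgue. (cmod (f t))\<^sup>2 * \<bar>t\<bar> powr (2 * \<mu>) = 0" by eventually_elim simp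
  qed
  finally show ?thesis
    by (simp add: X zero_aefun.abs_eq abs_aefun_eq_iff)
qed

lemma L2_Metric_space: "Metric_space (L2 \<mu>) (\<lambda>X Y. L2_norm \<mu> (X - Y))"
proof
  fix X Y Z :: aefun
  show "0 \<le> L2_norm \<mu> (X - Y)"
    by (rule L2_norm_nonneg)
  show "L2_norm \<mu> (X - Y) = L2_norm \<mu> (Y - X)"
    by transfer (simp add: norm_minus_commute)
  show "L2_norm \<mu> (X - Y) = 0 \<longleftrightarrow> X = Y" if "X \<in> L2 \<mu>" "Y \<in> L2 \<mu>"
    using L2_norm_eq_0_iff[OF aefun.subspace_diff[OF L2_subspace that]] by simp
  show "L2_norm \<mu> (X - Z) \<le> L2_norm \<mu> (X - Y) + L2_norm \<mu> (Y - Z)"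
    if "X \<in> L2 \<mu>" "Y \<in> L2 \<mu>" "Z \<in> L2 \<mu>"
    using L2_norm_add_le[of "X - Y" \<mu> "Y - Z"] that
    by (simp add: aefun.subspace_diff[OF L2_subspace])
qed

section \<open>Operators on \<open>L\<^sup>2\<^sub>\<mu>(\<real>)\<close>\<close>

text \<open>Only the values of an operator on \<open>L2 \<mu>\<close> matter.\<close>

definition L2_linear :: "real \<Rightarrow> (aefun \<Rightarrow> aefun) \<Rightarrow> bool" where
  "L2_linear \<mu> T \<longleftrightarrow>
     (\<forall>X\<in>L2 \<mu>. \<forall>Y\<in>L2 \<mu>. T (X + Y) = T X + T Y) \<and>
     (\<forall>c. \<forall>X\<in>L2 \<mu>. T (scale_aefun c X) = scale_aefun c (T X))"

definition L2_unitary :: "real \<Rightarrow> (aefun \<Rightarrow> aefun) \<Rightarrow> bool" where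
  "L2_unitary \<mu> T \<longleftrightarrow>
     bij_betw T (L2 \<mu>) (L2 \<mu>) \<and> L2_linear \<mu> T \<and>
     (\<forall>X\<in>L2 \<mu>. \<forall>Y\<in>L2 \<mu>. L2_inner \<mu> (T X) (T Y) = L2_inner \<mu> X Y)"

definition L2_adjoint :: "real \<Rightarrow> (aefun \<Rightarrow> aefun) \<Rightarrow> aefun \<Rightarrow> aefun" where
  "L2_adjoint \<mu> T Y =
     (THE Z. Z \<in> L2 \<mu> \<and> (\<forall>X\<in>L2 \<mu>. L2_inner \<mu> (T X) Y = L2_inner \<mu> X Z))"

definition L2_eigenvector :: "real \<Rightarrow> (aefun \<Rightarrow> aefun) \<Rightarrow> complex \<Rightarrow> aefun \<Rightarrow> bool" where
  "L2_eigenvector \<mu> T c X \<longleftrightarrow> X \<in> L2 \<mu> \<and> X \<noteq> 0 \<and> T X = scale_aefun c X"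

definition L2_eigenvalues :: "real \<Rightarrow> (aefun \<Rightarrow> aefun) \<Rightarrow> complex set" where
  "L2_eigenvalues \<mu> T = {c. \<exists>X. L2_eigenvector \<mu> T c X}"

definition L2_orthonormal :: "real \<Rightarrow> (nat \<Rightarrow> aefun) \<Rightarrow> bool" where
  "L2_orthonormal \<mu> e \<longleftrightarrow>
     range e \<subseteq> L2 \<mu> \<and> (\<forall>m n. L2_inner \<mu> (e m) (e n) = (if m = n then 1 else 0))"

definition L2_complete_orthonormal :: "real \<Rightarrow> (nat \<Rightarrow> aefun) \<Rightarrow> bool" where
  "L2_complete_orthonormal \<mu> e \<longleftrightarrow>
     L2_orthonormal \<mu> e \<and> L2_topology \<mu> closure_of aefun.span (range e) = L2 \<mu>"

section \<open>Generalized Hermite functions and the generalized Fourier transform\<close>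

definition gen_fact :: "real \<Rightarrow> nat \<Rightarrow> real" where
  "gen_fact \<mu> n =
     (if even n
      then 2 ^ n * fact (n div 2) * Gamma (real (n div 2) + \<mu> + 1/2) / Gamma (\<mu> + 1/2)
      else 2 ^ n * fact (n div 2) * Gamma (real (n div 2) + \<mu> + 3/2) / Gamma (\<mu> + 1/2))"

definition gen_exp :: "real \<Rightarrow> complex \<Rightarrow> complex" where
  "gen_exp \<mu> z = (\<Sum>m. z ^ m / complex_of_real (gen_fact \<mu> m))"

definition gen_hermite :: "real \<Rightarrow> nat \<Rightarrow> real \<Rightarrow> real" where
  "gen_hermite \<mu> n x =
     fact n * (\<Sum>k\<le>n div 2. (-1) ^ k * (2 * x) ^ (n - 2 * k) / (fact k * gen_fact \<mu> (n - 2 * k)))"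

definition hermite_fun :: "real \<Rightarrow> nat \<Rightarrow> real \<Rightarrow> complex" where
  "hermite_fun \<mu> n x = complex_of_real
     (sqrt (gen_fact \<mu> n / Gamma (\<mu> + 1/2)) * (1 / (2 powr (real n / 2) * fact n))
      * exp (- (x\<^sup>2) / 2) * gen_hermite \<mu> n x)"

definition hermite_span :: "real \<Rightarrow> (real \<Rightarrow> complex) set" where
  "hermite_span \<mu> = {\<lambda>x. \<Sum>n<N. c n * hermite_fun \<mu> n x |N c. True}"

text \<open>
  The kernel is \<open>e\<^sub>\<mu>(\<sigma> x t)\<close>: the Fourier transform has \<open>\<sigma> = -\<i>\<close> and its inverse has \<open>\<sigma> = \<i>\<close>.
\<close>

definition gft_integrand :: "real \<Rightarrow> complex \<Rightarrow> (real \<Rightarrow> complex) \<Rightarrow> real \<Rightarrow> real \<Rightarrow> complex" where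
  "gft_integrand \<mu> \<sigma> f x t =
     gen_exp \<mu> (\<sigma> * complex_of_real (x * t)) * f t * complex_of_real (\<bar>t\<bar> powr (2 * \<mu>))"

definition gft_integral :: "real \<Rightarrow> complex \<Rightarrow> (real \<Rightarrow> complex) \<Rightarrow> real \<Rightarrow> complex" where
  "gft_integral \<mu> \<sigma> f x =
     complex_of_real (inverse (2 powr (\<mu> + 1/2) * Gamma (\<mu> + 1/2))) *
     (LINT t|lebesgue. gft_integrand \<mu> \<sigma> f x t)"

definition gft_extension :: "real \<Rightarrow> (aefun \<Rightarrow> aefun) \<Rightarrow> bool" where
  "gft_extension \<mu> T \<longleftrightarrow>
     continuous_map (L2_topology \<mu>) (L2_topology \<mu>) T \<and>
     (\<forall>f\<in>hermite_span \<mu>. T (abs_aefun f) = abs_aefun (gft_integral \<mu> (-\<i>) f))"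

text \<open>Since the Hermite functions span a dense subspace, the choice is unique on \<open>L2 \<mu>\<close>.\<close>

definition gft :: "real \<Rightarrow> aefun \<Rightarrow> aefun" where
  "gft \<mu> = (SOME T. gft_extension \<mu> T)"

end

theory Submission
  imports Defs "HOL-Probability.Levy"
begin

text \<open>
  The generalized Hermite functions \<open>\<phi>\<^sub>n\<close> form an orthonormal basis of \<open>L\<^sup>2\<^sub>\<mu>\<close>, and the integral transform
  with kernel \<open>e\<^sub>\<mu>(\<sigma>xt)\<close>, where \<open>\<sigma>\<^sup>2 = -1\<close>, maps \<open>\<phi>\<^sub>n\<close> to \<open>\<sigma>\<^sup>n \<phi>\<^sub>n\<close>. So the transform is, on the span of
  the \<open>\<phi>\<^sub>n\<close>, the diagonal operator with entries \<open>(-\<i>)\<^sup>n\<close>. These have modulus one; the diagonal operator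
  is therefore a unitary operator on all of \<open>L\<^sup>2\<^sub>\<mu>\<close>, it is the only continuous extension, its
  eigenvalues are the numbers \<open>(-\<i>)\<^sup>n\<close>, and its adjoint is the diagonal operator with entries \<open>\<i>\<^sup>n\<close>,
  that is, the transform with the conjugate kernel.

  Orthonormality (\<open>has_bochner_integral_hermite_fun\<close>) and the eigenvalue equation (\<open>gft_hermite_fun\<close>)
  both come from one identity for power series coefficients, \<open>gen_fact_product_formula\<close>. The moments
  of \<open>exp (- s t\<^sup>2) \<bar>t\<bar>\<^sup>2\<^sup>\<mu>\<close> are values of \<open>\<gamma>\<^sub>\<mu>\<close> times coefficients of a Gaussian, so the identity
  evaluates the integral of \<open>e\<^sub>\<mu>(xt) e\<^sub>\<mu>(yt)\<close> against this weight. It is an instance of the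
  Chu-Vandermonde sum. Since \<open>H\<^sub>n\<^sup>\<mu>(x) / n!\<close> is the coefficient of \<open>z\<^sup>n\<close> in
  \<open>exp (- z\<^sup>2) e\<^sub>\<mu>(2xz)\<close>, all remaining sums are convolutions of coefficients of Gaussians.

  Completeness has two ingredients. If \<open>f\<close> is orthogonal to every \<open>\<phi>\<^sub>n\<close>, then
  \<open>f(t) exp (- t\<^sup>2/2) \<bar>t\<bar>\<^sup>2\<^sup>\<mu>\<close> has vanishing moments and finite exponential moments, so its Fourier
  transform vanishes, and \<open>f = 0\<close> by the uniqueness of characteristic functions
  (\<open>hermite_fun_total\<close>). And \<open>L\<^sup>2\<^sub>\<mu>\<close> is complete (\<open>L2_complete\<close>), so that the expansion of \<open>f\<close> converges,
  to a function with the same coefficients as \<open>f\<close>.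
\<close>

section \<open>Coefficient identities\<close>

text \<open>
  A form of the Chu-Vandermonde sum, symmetric in \<open>p\<close> and \<open>q\<close>: it is the binomial theorem for
  Pochhammer symbols at the arguments \<open>- q\<close> and \<open>1 - b - p\<close>, with all signs removed.
\<close>

lemma chu_vandermonde_pochhammer:
  fixes b :: real
  assumes b: "b > 0"
  shows "(\<Sum>r\<le>min p q. 1 / (fact r * pochhammer b r * fact (p - r) * fact (q - r)))
    = pochhammer b (p + q) / (fact p * fact q * pochhammer b p * pochhammer b q)"
proof -
  have pos: "pochhammer b n > 0" for n
    using b by (rule pochhammer_pos)
  have sgn: "(- 1) ^ r * (- 1) ^ (p - r) = ((- 1) ^ p :: real)" if "r \<le> p" for r
    using that by (simp flip: power_add)
  have "(- 1) ^ p * pochhammer (b + q) p = pochhammer (- real q + - (b + p - 1)) p"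
    using pochhammer_minus[of "b + p + q - 1" p] by (simp add: algebra_simps)
  also have "\<dots> = (\<Sum>r\<le>p. (p choose r) * pochhammer (- real q) r * pochhammer (- (b + p - 1)) (p - r))"
    by (rule pochhammer_binomial_sum)
  also have "\<dots> = (\<Sum>r\<le>p. (- 1) ^ p * ((p choose r) * pochhammer (real q - r + 1) r * pochhammer (b + r) (p - r)))"
  proof (rule sum.cong[OF refl])
    fix r assume "r \<in> {..p}"
    then have r: "r \<le> p" by simp
    have "pochhammer (- (b + p - 1)) (p - r) = (- 1) ^ (p - r) * pochhammer (b + r) (p - r)"
      using pochhammer_minus[of "b + p - 1" "p - r"] r by (simp add: of_nat_diff)
    moreover have "pochhammer (- real q) r = (- 1) ^ r * pochhammer (real q - r + 1) r"
      by (rule pochhammer_minus)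
    ultimately show "(p choose r) * pochhammer (- real q) r * pochhammer (- (b + p - 1)) (p - r)
        = (- 1) ^ p * ((p choose r) * pochhammer (real q - r + 1) r * pochhammer (b + r) (p - r))"
      using sgn[OF r] by (simp add: algebra_simps)
  qed
  also have "\<dots> = (- 1) ^ p * (\<Sum>r\<le>p. (p choose r) * pochhammer (real q - r + 1) r * pochhammer (b + r) (p - r))"
    by (simp add: sum_distrib_left)
  finally have V: "pochhammer (b + q) p
      = (\<Sum>r\<le>p. (p choose r) * pochhammer (real q - r + 1) r * pochhammer (b + r) (p - r))"
    by simp
  also have "\<dots> = (\<Sum>r\<le>min p q. (p choose r) * pochhammer (real q - r + 1) r * pochhammer (b + r) (p - r))"
  proof (rule sum.mono_neutral_right)
    show "\<forall>r\<in>{..p} - {..min p q}. (p choose r) * pochhammer (real q - r + 1) r * pochhammer (b + r) (p - r) = 0"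
    proof
      fix r assume "r \<in> {..p} - {..min p q}"
      then have "q < r" "r - Suc q < r" "real q - r + 1 = - real (r - Suc q)"
        by (auto simp: of_nat_diff)
      then have "pochhammer (real q - r + 1) r = 0"
        unfolding pochhammer_eq_0_iff by (intro exI[of _ "r - Suc q"]) simp
      then show "(p choose r) * pochhammer (real q - r + 1) r * pochhammer (b + r) (p - r) = 0"
        by simp
    qed
  qed auto
  also have "\<dots> = (\<Sum>r\<le>min p q. fact p * fact q * pochhammer b p *
      (1 / (fact r * pochhammer b r * fact (p - r) * fact (q - r))))"
  proof (rule sum.cong[OF refl])
    fix r assume "r \<in> {..min p q}"
    then have r: "r \<le> p" "r \<le> q" by auto
    have 1: "pochhammer (real q - r + 1) r * fact (q - r) = fact q"
      using pochhammer_product[of "q - r" q "1::real"] r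
      by (simp add: of_nat_diff algebra_simps flip: pochhammer_fact)
    have 2: "pochhammer b p = pochhammer b r * pochhammer (b + r) (p - r)"
      using r by (intro pochhammer_product)
    have 3: "real (p choose r) = fact p / (fact r * fact (p - r))"
      using r by (simp add: binomial_fact)
    show "(p choose r) * pochhammer (real q - r + 1) r * pochhammer (b + r) (p - r)
        = fact p * fact q * pochhammer b p * (1 / (fact r * pochhammer b r * fact (p - r) * fact (q - r)))"
      unfolding 2 3 using pos[of r] by (simp add: field_simps flip: 1)
  qed
  also have "\<dots> = fact p * fact q * pochhammer b p *
      (\<Sum>r\<le>min p q. 1 / (fact r * pochhammer b r * fact (p - r) * fact (q - r)))"
    by (simp add: sum_distrib_left)
  finally have S: "pochhammer (b + q) p = fact p * fact q * pochhammer b p *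
      (\<Sum>r\<le>min p q. 1 / (fact r * pochhammer b r * fact (p - r) * fact (q - r)))" .
  have P: "pochhammer b (p + q) = pochhammer b q * pochhammer (b + q) p"
    using pochhammer_product'[of b q p] by (simp add: add.commute)
  show ?thesis
    unfolding P S using pos[of p] pos[of q] by simp
qed

lemma gen_fact_even:
  assumes "\<mu> > - 1/2"
  shows "gen_fact \<mu> (2 * m) = 4 ^ m * fact m * pochhammer (\<mu> + 1/2) m"
proof -
  have "\<mu> + 1/2 \<notin> \<int>\<^sub>\<le>\<^sub>0"
    using assms by (auto elim!: nonpos_Ints_cases)
  moreover have "(2::real) ^ (2 * m) = 4 ^ m"
    by (simp add: power_mult)
  ultimately show ?thesis
    by (simp add: gen_fact_def pochhammer_Gamma add_ac)
qed

lemma gen_fact_odd: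
  assumes "\<mu> > - 1/2"
  shows "gen_fact \<mu> (Suc (2 * m)) = 2 * 4 ^ m * fact m * pochhammer (\<mu> + 1/2) (Suc m)"
proof -
  have "\<mu> + 1/2 \<notin> \<int>\<^sub>\<le>\<^sub>0"
    using assms by (auto elim!: nonpos_Ints_cases)
  moreover have "(2::real) ^ (2 * m) = 4 ^ m"
    by (simp add: power_mult)
  ultimately show ?thesis
    by (simp add: gen_fact_def pochhammer_Gamma add_ac)
qed

lemma gen_fact_pos:
  assumes "\<mu> > - 1/2"
  shows "gen_fact \<mu> n > 0"
proof -
  have "pochhammer (\<mu> + 1/2) m > 0" for m
    using assms by (intro pochhammer_pos) simp
  then show ?thesis
    using gen_fact_even[OF assms] gen_fact_odd[OF assms]
    by (cases "even n") (auto elim!: evenE oddE simp del: pochhammer_Suc)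
qed

lemma gen_fact_0: "\<mu> > - 1/2 \<Longrightarrow> gen_fact \<mu> 0 = 1"
  using gen_fact_even[of \<mu> 0] by simp

lemma gen_fact_Suc:
  fixes \<mu> :: real
  assumes "\<mu> > - 1/2"
  shows "gen_fact \<mu> (Suc n) = (real (Suc n) + (if even n then 2 * \<mu> else 0)) * gen_fact \<mu> n"
proof (cases "even n")
  case True
  then obtain m where m: "n = 2 * m" by (elim evenE)
  show ?thesis
    unfolding m gen_fact_even[OF assms] gen_fact_odd[OF assms]
    by (simp add: pochhammer_Suc algebra_simps)
next
  case False
  then obtain m where m: "n = Suc (2 * m)" by (metis oddE Suc_eq_plus1)
  then have "Suc n = 2 * Suc m" by simp
  then show ?thesis
    unfolding \<open>Suc n = 2 * Suc m\<close> gen_fact_even[OF assms]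
    unfolding m gen_fact_odd[OF assms] by simp
qed

text \<open>
  Each factor \<open>n + 2 \<mu> \<theta>\<^sub>n\<close> of \<open>\<gamma>\<^sub>\<mu>\<close>, where \<open>\<theta>\<^sub>n\<close> is 1 for odd and 0 for even \<open>n\<close>, is at least
  \<open>n\<close> times \<open>min 1 (1 + 2 \<mu>)\<close>. Hence \<open>e\<^sub>\<mu>\<close> grows at most exponentially, also for negative \<open>\<mu>\<close>.
\<close>

lemma gen_fact_lower_bound:
  assumes "\<mu> > - 1/2"
  shows "min 1 (1 + 2 * \<mu>) ^ n * fact n \<le> gen_fact \<mu> n"
proof (induction n)
  case 0
  then show ?case using assms by (simp add: gen_fact_0)
next
  case (Suc n)
  have \<kappa>: "min 1 (1 + 2 * \<mu>) * Suc n \<le> Suc n + (if even n then 2 * \<mu> else 0)"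
  proof (cases "even n \<and> \<mu> < 0")
    case True
    have "2 * \<mu> * real n \<le> 0"
      using True by (simp add: mult_nonpos_nonneg)
    with True show ?thesis by (simp add: algebra_simps min_def)
  next
    case False
    have "min 1 (1 + 2 * \<mu>) * real n \<le> 1 * real n"
      by (intro mult_right_mono) auto
    with False show ?thesis by (auto simp: algebra_simps)
  qed
  have "min 1 (1 + 2 * \<mu>) ^ Suc n * fact (Suc n)
      = (min 1 (1 + 2 * \<mu>) * Suc n) * (min 1 (1 + 2 * \<mu>) ^ n * fact n)"
    by simp
  also have "\<dots> \<le> (Suc n + (if even n then 2 * \<mu> else 0)) * gen_fact \<mu> n"
    using assms \<kappa> Suc.IH by (intro mult_mono) (auto simp: min_def)
  also have "\<dots> = gen_fact \<mu> (Suc n)"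
    by (simp only: gen_fact_Suc[OF assms])
  finally show ?case .
qed

text \<open>The coefficient of \<open>z\<^sup>k\<close> in the power series of \<open>exp (s z\<^sup>2)\<close>.\<close>

definition gauss_coeff :: "real \<Rightarrow> nat \<Rightarrow> real" where
  "gauss_coeff s k = (if even k then s ^ (k div 2) / fact (k div 2) else 0)"

lemma gauss_coeff_even [simp]: "gauss_coeff s (2 * m) = s ^ m / fact m"
  and gauss_coeff_odd: "odd k \<Longrightarrow> gauss_coeff s k = 0"
  by (simp_all add: gauss_coeff_def)

lemma gauss_coeff_0 [simp]: "gauss_coeff s 0 = 1"
  by (simp add: gauss_coeff_def)

lemma gauss_coeff_scale: "a ^ k * gauss_coeff s k = gauss_coeff (a\<^sup>2 * s) k"
  by (auto simp: gauss_coeff_def power_mult_distrib elim!: evenE simp flip: power_mult)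

lemma gauss_coeff_0_left: "gauss_coeff 0 k = (if k = 0 then 1 else 0)"
  by (auto simp: gauss_coeff_def elim!: evenE)

lemma sum_even_indices:
  fixes f :: "nat \<Rightarrow> 'a::comm_monoid_add"
  assumes "\<And>j. j \<le> n \<Longrightarrow> odd j \<Longrightarrow> f j = 0"
  shows "(\<Sum>j\<le>n. f j) = (\<Sum>i\<le>n div 2. f (2 * i))"
proof -
  have "(\<Sum>j\<le>n. f j) = (\<Sum>j\<in>(\<lambda>i. 2 * i) ` {..n div 2}. f j)"
  proof (rule sum.mono_neutral_right)
    show "\<forall>j\<in>{..n} - (\<lambda>i. 2 * i) ` {..n div 2}. f j = 0"
    proof
      fix j assume j: "j \<in> {..n} - (\<lambda>i. 2 * i) ` {..n div 2}"
      have "odd j"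
      proof
        assume "even j"
        with j show False by (auto elim!: evenE simp: image_iff)
      qed
      with j show "f j = 0" by (simp add: assms)
    qed
  qed auto
  also have "\<dots> = (\<Sum>i\<le>n div 2. f (2 * i))"
    by (subst sum.reindex) (auto simp: inj_on_def)
  finally show ?thesis .
qed

lemma gauss_coeff_convolution:
  "(\<Sum>j\<le>n. gauss_coeff s (n - j) * gauss_coeff t j) = gauss_coeff (s + t) n"
proof (cases "even n")
  case True
  then obtain m where n: "n = 2 * m" by (elim evenE)
  have "(\<Sum>j\<le>n. gauss_coeff s (n - j) * gauss_coeff t j)
      = (\<Sum>i\<le>m. gauss_coeff s (2 * m - 2 * i) * gauss_coeff t (2 * i))"
    using n by (subst sum_even_indices) (auto simp: gauss_coeff_odd)
  also have "\<dots> = (\<Sum>i\<le>m. s ^ (m - i) / fact (m - i) * (t ^ i / fact i))"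
    by (simp flip: right_diff_distrib')
  also have "\<dots> = (\<Sum>i\<le>m. (m choose i) * t ^ i * s ^ (m - i)) / fact m"
    by (auto simp: sum_divide_distrib binomial_fact mult_ac intro!: sum.cong)
  also have "\<dots> = gauss_coeff (s + t) n"
    by (simp add: n add.commute[of s] flip: binomial_ring)
  finally show ?thesis .
next
  case False
  then have "gauss_coeff s (n - j) * gauss_coeff t j = 0" if "j \<le> n" for j
    using that by (cases "even j") (auto simp: gauss_coeff_odd)
  then have "(\<Sum>j\<le>n. gauss_coeff s (n - j) * gauss_coeff t j) = 0"
    by (intro sum.neutral) simp
  with False show ?thesis by (simp add: gauss_coeff_odd)
qed

lemma gauss_coeff_convolution_from:
  assumes "l \<le> n"
  shows "(\<Sum>j=l..n. gauss_coeff s (n - j) * gauss_coeff t (j - l)) = gauss_coeff (s + t) (n - l)"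
proof -
  have "(\<Sum>j=l..n. gauss_coeff s (n - j) * gauss_coeff t (j - l))
      = (\<Sum>j\<le>n - l. gauss_coeff s (n - l - j) * gauss_coeff t j)"
    using assms by (intro sum.reindex_bij_witness[of _ "\<lambda>j. j + l" "\<lambda>j. j - l"]) auto
  then show ?thesis by (simp only: gauss_coeff_convolution)
qed

text \<open>
  The coefficient of \<open>x\<^sup>j y\<^sup>k\<close> in the product formula
  \<open>\<integral> e\<^sub>\<mu>(xt) e\<^sub>\<mu>(yt) exp(-t\<^sup>2/2) \<bar>t\<bar>\<^sup>2\<^sup>\<mu> dt = C exp((x\<^sup>2 + y\<^sup>2)/2) e\<^sub>\<mu>(xy)\<close>, where \<open>C\<close> is the
  integral for \<open>x = y = 0\<close>; the numerator on the left is, up to \<open>C\<close>, the moment of order \<open>j + k\<close>.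
\<close>

lemma gen_fact_product_formula:
  assumes \<mu>: "\<mu> > - 1/2"
  shows "gen_fact \<mu> (j + k) * gauss_coeff (1/2) (j + k) / (gen_fact \<mu> j * gen_fact \<mu> k)
    = (\<Sum>l\<le>min j k. gauss_coeff (1/2) (j - l) * gauss_coeff (1/2) (k - l) / gen_fact \<mu> l)"
    (is "?L = sum ?f _")
proof -
  let ?a = "\<mu> + 1/2"
  have a: "?a > 0" using \<mu> by simp
  have pos: "pochhammer ?a n > 0" for n
    using a by (rule pochhammer_pos)
  consider p q where "j = 2 * p" "k = 2 * q" | p q where "j = Suc (2 * p)" "k = Suc (2 * q)"
    | "odd (j + k)"
    by (metis evenE oddE Suc_eq_plus1 odd_add)
  then show ?thesis
  proof cases
    case 1
    have "min j k = 2 * min p q"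
      using 1 by simp
    then have "sum ?f {..min j k} = (\<Sum>r\<le>min p q. ?f (2 * r))"
      using 1 by (subst sum_even_indices) (auto simp: gauss_coeff_odd)
    also have "\<dots> = (\<Sum>r\<le>min p q. 1 / 2 ^ (p + q) *
        (1 / (fact r * pochhammer ?a r * fact (p - r) * fact (q - r))))"
    proof (rule sum.cong[OF refl])
      fix r assume "r \<in> {..min p q}"
      then obtain p' q' where "p = r + p'" "q = r + q'"
        by (metis atMost_iff le_Suc_ex min.boundedE)
      moreover have "(4::real) ^ r = 2 ^ r * 2 ^ r"
        by (simp flip: power_mult_distrib)
      ultimately show "?f (2 * r) = 1 / 2 ^ (p + q) * (1 / (fact r * pochhammer ?a r * fact (p - r) * fact (q - r)))"
        unfolding gen_fact_even[OF \<mu>] using 1 pos[of r]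
        by (simp add: power_add flip: right_diff_distrib') (simp add: divide_simps)
    qed
    also have "\<dots> = 1 / 2 ^ (p + q) *
        (pochhammer ?a (p + q) / (fact p * fact q * pochhammer ?a p * pochhammer ?a q))"
      by (simp only: chu_vandermonde_pochhammer[OF a] flip: sum_distrib_left)
    also have "\<dots> = ?L"
    proof -
      have "(4::real) ^ n = 2 ^ n * 2 ^ n" for n
        by (simp flip: power_mult_distrib)
      moreover have "j + k = 2 * (p + q)" using 1 by simp
      ultimately show ?thesis
        unfolding \<open>j + k = 2 * (p + q)\<close> gauss_coeff_even gen_fact_even[OF \<mu>]
        unfolding 1 gen_fact_even[OF \<mu>]
        using pos[of p] pos[of q]
        by (simp add: power_add divide_simps)
    qed
    finally show ?thesis ..
  next
    case 2
    have Suc: "pochhammer ?a (Suc n) = ?a * pochhammer (?a + 1) n" for n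
      by (rule pochhammer_rec)
    have pos': "pochhammer (?a + 1) n > 0" for n
      using a by (intro pochhammer_pos) simp
    have "sum ?f {..min j k} = (\<Sum>l\<le>2 * min p q. ?f (Suc l))"
    proof -
      have "{..min j k} = {..Suc (2 * min p q)}"
        using 2 by auto
      moreover have "?f 0 = 0"
        using 2 by (simp add: gauss_coeff_odd)
      ultimately show ?thesis
        by (simp add: sum.atMost_Suc_shift del: sum.atMost_Suc)
    qed
    also have "\<dots> = (\<Sum>r\<le>min p q. ?f (Suc (2 * r)))"
      using 2 by (subst sum_even_indices) (auto simp: gauss_coeff_odd)
    also have "\<dots> = (\<Sum>r\<le>min p q. 1 / (2 * ?a * 2 ^ (p + q)) *
        (1 / (fact r * pochhammer (?a + 1) r * fact (p - r) * fact (q - r))))"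
    proof (rule sum.cong[OF refl])
      fix r assume "r \<in> {..min p q}"
      then obtain p' q' where "p = r + p'" "q = r + q'"
        by (metis atMost_iff le_Suc_ex min.boundedE)
      moreover have "(4::real) ^ r = 2 ^ r * 2 ^ r"
        by (simp flip: power_mult_distrib)
      ultimately show "?f (Suc (2 * r)) = 1 / (2 * ?a * 2 ^ (p + q)) *
          (1 / (fact r * pochhammer (?a + 1) r * fact (p - r) * fact (q - r)))"
        unfolding gen_fact_odd[OF \<mu>] Suc using 2 pos'[of r] a
        by (simp add: power_add flip: right_diff_distrib') (simp add: divide_simps)
    qed
    also have "\<dots> = 1 / (2 * ?a * 2 ^ (p + q)) *
        (pochhammer (?a + 1) (p + q) / (fact p * fact q * pochhammer (?a + 1) p * pochhammer (?a + 1) q))"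
      using a by (simp only: chu_vandermonde_pochhammer flip: sum_distrib_left)
    also have "\<dots> = ?L"
    proof -
      have "(4::real) ^ n = 2 ^ n * 2 ^ n" for n
        by (simp flip: power_mult_distrib)
      moreover have jk: "j + k = 2 * (Suc (p + q))" using 2 by simp
      ultimately show ?thesis
        unfolding jk gauss_coeff_even gen_fact_even[OF \<mu>] Suc
        unfolding 2 gen_fact_odd[OF \<mu>] Suc
        using pos'[of p] pos'[of q] a
        by (simp add: power_add divide_simps del: fact_Suc) 
    qed
    finally show ?thesis ..
  next
    case 3
    have "?f l = 0" if "l \<le> min j k" for l
      using that 3 by (cases "even l") (auto simp: gauss_coeff_odd)
    then have "sum ?f {..min j k} = 0"
      by (intro sum.neutral) auto
    with 3 show ?thesis by (simp add: gauss_coeff_odd)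
  qed
qed

lemma gen_fact_product_formula_scaled:
  assumes \<mu>: "\<mu> > - 1/2" and s: "s \<ge> 0"
  shows "gen_fact \<mu> (j + k) * gauss_coeff s (j + k) / (gen_fact \<mu> j * gen_fact \<mu> k)
    = (\<Sum>l\<le>min j k. (2 * s) ^ l * gauss_coeff s (j - l) * gauss_coeff s (k - l) / gen_fact \<mu> l)"
proof -
  let ?r = "sqrt (2 * s)"
  have r: "?r ^ k * gauss_coeff (1/2) k = gauss_coeff s k" for k
    using s by (simp add: gauss_coeff_scale)
  have "gen_fact \<mu> (j + k) * gauss_coeff s (j + k) / (gen_fact \<mu> j * gen_fact \<mu> k)
      = ?r ^ (j + k) * (gen_fact \<mu> (j + k) * gauss_coeff (1/2) (j + k) / (gen_fact \<mu> j * gen_fact \<mu> k))"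
    by (simp flip: r)
  also have "\<dots> = (\<Sum>l\<le>min j k. (2 * s) ^ l * gauss_coeff s (j - l) * gauss_coeff s (k - l) / gen_fact \<mu> l)"
    unfolding gen_fact_product_formula[OF \<mu>] sum_distrib_left
  proof (rule sum.cong[OF refl])
    fix l assume "l \<in> {..min j k}"
    then obtain j' k' where "j = l + j'" "k = l + k'"
      by (metis atMost_iff le_Suc_ex min.boundedE)
    moreover have "?r * ?r = 2 * s"
      using s by simp
    then have "(2 * s) ^ l = ?r ^ l * ?r ^ l"
      by (metis power_mult_distrib)
    ultimately show "?r ^ (j + k) * (gauss_coeff (1/2) (j - l) * gauss_coeff (1/2) (k - l) / gen_fact \<mu> l)
        = (2 * s) ^ l * gauss_coeff s (j - l) * gauss_coeff s (k - l) / gen_fact \<mu> l"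
      by (simp add: power_add mult_ac flip: r)
  qed
  finally show ?thesis .
qed

section \<open>Gaussian moments\<close>

text \<open>
  The substitution \<open>u = s t\<^sup>2\<close> in Euler's integral, which applies in the same way on both half-lines.
\<close>

lemma half_line_abs_powr_gauss_integral:
  fixes x s :: real
  assumes x: "x > 0" and s: "s > 0" and S: "S = {0<..} \<or> S = {..<0::real}"
  shows "((\<lambda>t. \<bar>t\<bar> powr (2 * x - 1) * exp (- (s * t\<^sup>2))) has_integral Gamma x / (2 * s powr x)) S"
proof -
  let ?f = "\<lambda>u::real. u powr (x - 1) / exp u"
  have img: "(\<lambda>t. s * t\<^sup>2) ` S = {0<..}"
  proof -
    have "y \<in> (\<lambda>t. s * t\<^sup>2) ` S" if "y > 0" for y
    proof -
      have "y = s * (sqrt (y / s))\<^sup>2" "y = s * (- sqrt (y / s))\<^sup>2" "sqrt (y / s) > 0"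
        using that s by (simp_all add: real_sqrt_pow2)
      with S show ?thesis
        by (auto intro: image_eqI[of _ _ "sqrt (y / s)"] image_eqI[of _ _ "- sqrt (y / s)"])
    qed
    moreover have "s * t\<^sup>2 > 0" if "t \<in> S" for t
      using that S s by auto
    ultimately show ?thesis by auto
  qed
  have "inj_on (\<lambda>t. s * t\<^sup>2) S"
    using S s by (auto simp: inj_on_def power2_eq_iff)
  moreover have "((\<lambda>t. s * t\<^sup>2) has_field_derivative 2 * s * t) (at t within S)" for t
    by (auto intro!: derivative_eq_intros)
  moreover have "S \<in> sets lebesgue"
    using S by auto
  ultimately have cov: "(\<lambda>t. \<bar>2 * s * t\<bar> * ?f (s * t\<^sup>2)) absolutely_integrable_on S
        \<and> integral S (\<lambda>t. \<bar>2 * s * t\<bar> * ?f (s * t\<^sup>2)) = Gamma x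
      \<longleftrightarrow> ?f absolutely_integrable_on {0<..} \<and> integral {0<..} ?f = Gamma x"
    by (subst has_absolute_integral_change_of_variables_1') (auto simp: img)
  have "(?f has_integral Gamma x) {0<..}"
  proof -
    have "{u \<in> {0..} - {0<..}. ?f u \<noteq> 0} \<subseteq> {0}" "{u \<in> {0<..} - {0..}. ?f u \<noteq> 0} \<subseteq> {0}"
      by auto
    then show ?thesis
      using Gamma_integral_real[OF x]
        has_integral_spike_set_eq[of "{0..}" "{0<..}" ?f, OF negligible_subset negligible_subset]
      by blast
  qed
  then have "?f absolutely_integrable_on {0<..} \<and> integral {0<..} ?f = Gamma x"
    by (auto intro!: nonnegative_absolutely_integrable_1 simp: has_integral_iff)
  then have "(\<lambda>t. \<bar>2 * s * t\<bar> * ?f (s * t\<^sup>2)) absolutely_integrable_on S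
      \<and> integral S (\<lambda>t. \<bar>2 * s * t\<bar> * ?f (s * t\<^sup>2)) = Gamma x"
    by (rule iffD2[OF cov])
  then have "((\<lambda>t. \<bar>2 * s * t\<bar> * ?f (s * t\<^sup>2)) has_integral Gamma x) S"
    by (auto simp: has_integral_iff dest: set_lebesgue_integral_eq_integral(1))
  then have "((\<lambda>t. 1 / (2 * s powr x) * (\<bar>2 * s * t\<bar> * ?f (s * t\<^sup>2))) has_integral 1 / (2 * s powr x) * Gamma x) S"
    by (rule has_integral_mult_right)
  moreover have "1 / (2 * s powr x) * (\<bar>2 * s * t\<bar> * ?f (s * t\<^sup>2)) = \<bar>t\<bar> powr (2 * x - 1) * exp (- (s * t\<^sup>2))"
    if "t \<in> S" for t
  proof -
    have t: "\<bar>t\<bar> > 0" using that S by auto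
    have "(s * t\<^sup>2) powr (x - 1) = s powr (x - 1) * (\<bar>t\<bar>\<^sup>2) powr (x - 1)"
      using s by (simp add: powr_mult)
    also have "(\<bar>t\<bar>\<^sup>2) powr (x - 1) = \<bar>t\<bar> powr (2 * (x - 1))"
    proof -
      have "\<bar>t\<bar> powr 2 = \<bar>t\<bar>\<^sup>2"
        using t by (intro powr_numeral) simp
      then show ?thesis by (metis powr_powr)
    qed
    finally have e1: "(s * t\<^sup>2) powr (x - 1) = s powr (x - 1) * \<bar>t\<bar> powr (2 * (x - 1))" .
    have e2: "s powr (x - 1) * s = s powr x"
      using s by (simp add: powr_diff)
    have e3: "\<bar>t\<bar> powr (2 * (x - 1)) * \<bar>t\<bar> = \<bar>t\<bar> powr (2 * x - 1)"
      using t powr_add[of "\<bar>t\<bar>" "2 * (x - 1)" 1] by (simp add: algebra_simps)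
    have "\<bar>2 * s * t\<bar> * (s * t\<^sup>2) powr (x - 1) = 2 * ((s powr (x - 1) * s) * (\<bar>t\<bar> powr (2 * (x - 1)) * \<bar>t\<bar>))"
      unfolding e1 using s by (simp add: abs_mult)
    also have "\<dots> = 2 * (s powr x * \<bar>t\<bar> powr (2 * x - 1))"
      by (simp only: e2 e3)
    finally have "\<bar>2 * s * t\<bar> * (s * t\<^sup>2) powr (x - 1) = 2 * (s powr x * \<bar>t\<bar> powr (2 * x - 1))" .
    then show ?thesis
      using s by (simp add: exp_minus divide_simps)
  qed
  ultimately have "((\<lambda>t. \<bar>t\<bar> powr (2 * x - 1) * exp (- (s * t\<^sup>2))) has_integral 1 / (2 * s powr x) * Gamma x) S"
    by (rule has_integral_eq[rotated])
  then show ?thesis by simp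
qed

lemma has_bochner_integral_abs_powr_gauss:
  fixes x s :: real
  assumes x: "x > 0" and s: "s > 0"
  shows "has_bochner_integral lebesgue (\<lambda>t. \<bar>t\<bar> powr (2 * x - 1) * exp (- (s * t\<^sup>2))) (Gamma x / s powr x)"
proof -
  let ?f = "\<lambda>t. \<bar>t\<bar> powr (2 * x - 1) * exp (- (s * t\<^sup>2))"
  have "(?f has_integral Gamma x / (2 * s powr x) + Gamma x / (2 * s powr x)) ({0<..} \<union> {..<0})"
    proof (intro has_integral_Un half_line_abs_powr_gauss_integral)
    have "{0<..} \<inter> {..<0::real} = {}" by auto
    then show "negligible ({0<..} \<inter> {..<0::real})" by simp
  qed (use assms in auto)
  then have "(?f has_integral Gamma x / s powr x) UNIV"
  proof -
    assume *: "(?f has_integral Gamma x / (2 * s powr x) + Gamma x / (2 * s powr x)) ({0<..} \<union> {..<0})"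
    have "{t \<in> {0<..} \<union> {..<0} - UNIV. ?f t \<noteq> 0} \<subseteq> {0}" "{t \<in> UNIV - ({0<..} \<union> {..<0}). ?f t \<noteq> 0} \<subseteq> {0}"
      by auto
    from has_integral_spike_set_eq[OF this[THEN negligible_subset[rotated]]] * show ?thesis
      by simp
  qed
  then have "integral\<^sup>N lborel ?f = ennreal (Gamma x / s powr x)"
    by (intro nn_integral_has_integral_lborel) auto
  then have "has_bochner_integral lborel ?f (Gamma x / s powr x)"
    using x Gamma_real_pos[OF x] by (intro has_bochner_integral_nn_integral) auto
  then show ?thesis
    by (simp add: has_bochner_integral_iff integrable_completion integral_completion)
qed

text \<open>
  The weight \<open>\<bar>t\<bar>\<^sup>2\<^sup>\<mu>\<close> times a Gaussian. Here \<open>s = 1/2\<close> occurs in the transform of a Hermite function and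
  \<open>s = 1\<close> in the inner product of two of them.
\<close>

definition gauss_weight :: "real \<Rightarrow> real \<Rightarrow> real \<Rightarrow> real" where
  "gauss_weight \<mu> s t = exp (- (s * t\<^sup>2)) * \<bar>t\<bar> powr (2 * \<mu>)"

lemma gauss_weight_nonneg: "0 \<le> gauss_weight \<mu> s t"
  by (simp add: gauss_weight_def)

lemma gauss_weight_measurable [measurable]: "gauss_weight \<mu> s \<in> borel_measurable borel"
  unfolding gauss_weight_def by measurable

lemma has_bochner_integral_abs_moment:
  assumes \<mu>: "\<mu> > - 1/2" and s: "s > 0"
  shows "has_bochner_integral lebesgue (\<lambda>t. \<bar>t\<bar> ^ k * gauss_weight \<mu> s t)
    (Gamma (real k / 2 + (\<mu> + 1/2)) / s powr (real k / 2 + (\<mu> + 1/2)))"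
proof -
  have "real k / 2 + (\<mu> + 1/2) > 0"
    using \<mu> by (simp add: add_nonneg_pos)
  note has_bochner_integral_abs_powr_gauss[OF this s]
  moreover have "\<bar>t\<bar> powr (2 * (real k / 2 + (\<mu> + 1/2)) - 1) * exp (- (s * t\<^sup>2)) = \<bar>t\<bar> ^ k * gauss_weight \<mu> s t" for t
  proof (cases "t = 0")
    case False
    have "2 * (real k / 2 + (\<mu> + 1/2)) - 1 = real k + 2 * \<mu>"
      by (simp add: field_simps)
    with False show ?thesis
      by (simp only: powr_add) (simp add: gauss_weight_def powr_realpow)
  qed (simp add: gauss_weight_def)
  ultimately show ?thesis by simp
qed

lemma gauss_weight_measurable_lebesgue [measurable]: "gauss_weight \<mu> s \<in> borel_measurable lebesgue"
  by (rule measurable_completion) measurable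

lemma integrable_exp_gauss_weight:
  assumes \<mu>: "\<mu> > - 1/2" and s: "s > 0"
  shows "integrable lebesgue (\<lambda>t. exp (A * \<bar>t\<bar>) * gauss_weight \<mu> s t)"
proof (rule Bochner_Integration.integrable_bound)
  show "integrable lebesgue (\<lambda>t. exp (A\<^sup>2 / (2 * s)) * (\<bar>t\<bar> ^ 0 * gauss_weight \<mu> (s / 2) t))"
    using has_bochner_integral_abs_moment[OF \<mu>, of "s / 2" 0] s
    by (intro integrable_mult_right) (simp add: has_bochner_integral_iff)
  show "(\<lambda>t. exp (A * \<bar>t\<bar>) * gauss_weight \<mu> s t) \<in> borel_measurable lebesgue"
    by (rule measurable_completion) measurable
  show "AE t in lebesgue. norm (exp (A * \<bar>t\<bar>) * gauss_weight \<mu> s t)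
      \<le> norm (exp (A\<^sup>2 / (2 * s)) * (\<bar>t\<bar> ^ 0 * gauss_weight \<mu> (s / 2) t))"
  proof (rule AE_I2)
    fix t :: real
    have "0 \<le> (s * \<bar>t\<bar> - A)\<^sup>2 / (2 * s)"
      using s by simp
    also have "\<dots> = A\<^sup>2 / (2 * s) - s / 2 * t\<^sup>2 - (A * \<bar>t\<bar> - s * t\<^sup>2)"
      using s by (simp add: power2_diff power_mult_distrib field_simps power2_eq_square)
    finally have "exp (A * \<bar>t\<bar>) * exp (- (s * t\<^sup>2)) \<le> exp (A\<^sup>2 / (2 * s)) * exp (- (s / 2 * t\<^sup>2))"
      by (simp flip: exp_add)
    then have "exp (A * \<bar>t\<bar>) * exp (- (s * t\<^sup>2)) * \<bar>t\<bar> powr (2 * \<mu>)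
        \<le> exp (A\<^sup>2 / (2 * s)) * exp (- (s / 2 * t\<^sup>2)) * \<bar>t\<bar> powr (2 * \<mu>)"
      by (rule mult_right_mono) simp
    then show "norm (exp (A * \<bar>t\<bar>) * gauss_weight \<mu> s t)
        \<le> norm (exp (A\<^sup>2 / (2 * s)) * (\<bar>t\<bar> ^ 0 * gauss_weight \<mu> (s / 2) t))"
      by (simp add: gauss_weight_def abs_mult mult.assoc)
  qed
qed

text \<open>
  With the moments written in terms of \<open>\<gamma>\<^sub>\<mu>\<close> and \<^const>\<open>gauss_coeff\<close>, even and odd orders need no
  separate treatment.
\<close>

lemma has_bochner_integral_moment:
  assumes \<mu>: "\<mu> > - 1/2" and s: "s > 0"
  shows "has_bochner_integral lebesgue (\<lambda>t. t ^ k * gauss_weight \<mu> s t)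
    (Gamma (\<mu> + 1/2) / s powr (\<mu> + 1/2) * (gen_fact \<mu> k * gauss_coeff (1 / (4 * s)) k))"
proof (cases "even k")
  case True
  then obtain m where k: "k = 2 * m" by (elim evenE)
  have "\<mu> + 1/2 \<notin> \<int>\<^sub>\<le>\<^sub>0"
    using \<mu> by (auto elim!: nonpos_Ints_cases)
  then have P: "pochhammer (\<mu> + 1/2) m = Gamma (real k / 2 + (\<mu> + 1/2)) / Gamma (\<mu> + 1/2)"
    by (simp add: pochhammer_Gamma k add_ac)
  have "s powr (real k / 2 + (\<mu> + 1/2)) = s powr (\<mu> + 1/2) * s ^ m"
    using s by (simp add: k powr_add powr_realpow)
  moreover have "Gamma (\<mu> + 1/2) > 0"
    using \<mu> by (intro Gamma_real_pos) simp
  ultimately have "Gamma (\<mu> + 1/2) / s powr (\<mu> + 1/2) * (gen_fact \<mu> k * gauss_coeff (1 / (4 * s)) k)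
      = Gamma (real k / 2 + (\<mu> + 1/2)) / s powr (real k / 2 + (\<mu> + 1/2))"
    unfolding k gen_fact_even[OF \<mu>] gauss_coeff_even unfolding k[symmetric] P
    using s by (simp add: power_divide power_mult_distrib)
  then show ?thesis
    using has_bochner_integral_abs_moment[OF \<mu> s, of k] True by (simp only: power_even_abs)
next
  case False
  let ?f = "\<lambda>t. t ^ k * gauss_weight \<mu> s t"
  have [measurable]: "?f \<in> borel_measurable lebesgue"
    by (rule measurable_completion) measurable
  have "integrable lebesgue (\<lambda>t. \<bar>t\<bar> ^ k * gauss_weight \<mu> s t)"
    using has_bochner_integral_abs_moment[OF \<mu> s] by (auto simp: has_bochner_integral_iff)
  then have "integrable lebesgue ?f"
    by (rule Bochner_Integration.integrable_bound)
      (auto simp: abs_mult power_abs gauss_weight_nonneg)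
  moreover have "integral\<^sup>L lebesgue ?f = (LINT t|lebesgue. ?f (- t))"
    using lebesgue_integral_real_affine[of "-1" ?f 0] by simp
  then have "integral\<^sup>L lebesgue ?f = - integral\<^sup>L lebesgue ?f"
    using False by (simp add: gauss_weight_def)
  then have "integral\<^sup>L lebesgue ?f = 0"
    by simp
  ultimately show ?thesis
    using False by (simp add: has_bochner_integral_iff gauss_coeff_odd)
qed

section \<open>The generalized exponential function\<close>

text \<open>
  A constant \<open>\<kappa>\<close> such that \<open>\<bar>e\<^sub>\<mu>(z)\<bar> \<le> exp (\<kappa> \<bar>z\<bar>)\<close>, and likewise for all partial sums of the series.
\<close>

definition gen_exp_rate :: "real \<Rightarrow> real" where
  "gen_exp_rate \<mu> = 1 / min 1 (1 + 2 * \<mu>)"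

lemma gen_exp_rate_pos: "\<mu> > - 1/2 \<Longrightarrow> gen_exp_rate \<mu> > 0"
  by (simp add: gen_exp_rate_def min_def)

lemma norm_gen_exp_term_le:
  fixes z :: complex
  assumes \<mu>: "\<mu> > - 1/2"
  shows "norm (z ^ m / complex_of_real (gen_fact \<mu> m)) \<le> (gen_exp_rate \<mu> * norm z) ^ m / fact m"
proof -
  let ?k = "min 1 (1 + 2 * \<mu>)"
  have k: "?k > 0" using \<mu> by auto
  have "norm (z ^ m / complex_of_real (gen_fact \<mu> m)) = norm z ^ m / gen_fact \<mu> m"
    using gen_fact_pos[OF \<mu>, of m] by (simp add: norm_divide norm_power)
  also have "\<dots> \<le> norm z ^ m / (?k ^ m * fact m)"
    using k by (intro divide_left_mono gen_fact_lower_bound[OF \<mu>]) (auto intro!: mult_pos_pos gen_fact_pos \<mu>)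
  also have "\<dots> = (gen_exp_rate \<mu> * norm z) ^ m / fact m"
    by (simp add: gen_exp_rate_def power_mult_distrib power_divide)
  finally show ?thesis .
qed

lemma summable_exp_real: "summable (\<lambda>m. (x::real) ^ m / fact m)"
  using summable_exp_generic[of x] by (simp add: divide_inverse mult.commute)

lemma gen_exp_sums:
  assumes \<mu>: "\<mu> > - 1/2"
  shows "(\<lambda>m. z ^ m / complex_of_real (gen_fact \<mu> m)) sums gen_exp \<mu> z"
proof -
  have "summable (\<lambda>m. z ^ m / complex_of_real (gen_fact \<mu> m))"
    by (rule summable_comparison_test'[OF summable_exp_real norm_gen_exp_term_le[OF \<mu>]])
  then show ?thesis
    unfolding gen_exp_def by (rule summable_sums)
qed

lemma exp_partial_sum_le:
  fixes x :: real
  assumes "x \<ge> 0"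
  shows "(\<Sum>m<N. x ^ m / fact m) \<le> exp x"
proof -
  have "(\<Sum>m<N. x ^ m / fact m) \<le> (\<Sum>m. x ^ m / fact m)"
    using assms by (intro sum_le_suminf summable_exp_real) auto
  also have "\<dots> = exp x"
    by (simp add: exp_def divide_inverse mult.commute)
  finally show ?thesis .
qed

lemma norm_gen_exp_partial_sum_le:
  assumes \<mu>: "\<mu> > - 1/2"
  shows "norm (\<Sum>m<N. z ^ m / complex_of_real (gen_fact \<mu> m)) \<le> exp (gen_exp_rate \<mu> * norm z)"
proof -
  have "norm (\<Sum>m<N. z ^ m / complex_of_real (gen_fact \<mu> m)) \<le> (\<Sum>m<N. (gen_exp_rate \<mu> * norm z) ^ m / fact m)"
    by (intro sum_norm_le norm_gen_exp_term_le \<mu>)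
  also have "\<dots> \<le> exp (gen_exp_rate \<mu> * norm z)"
    using gen_exp_rate_pos[OF \<mu>] by (intro exp_partial_sum_le) simp
  finally show ?thesis .
qed

lemma power_le_fact_exp:
  fixes x :: real
  assumes "x \<ge> 0"
  shows "x ^ j \<le> fact j * exp x"
proof -
  have "x ^ j / fact j \<le> (\<Sum>m<Suc j. x ^ m / fact m)"
    using assms by (intro member_le_sum) auto
  also have "\<dots> \<le> exp x"
    by (rule exp_partial_sum_le[OF assms])
  finally show ?thesis by (simp add: field_simps)
qed

text \<open>
  Integration of \<open>e\<^sub>\<mu>(zt)\<close> against a monomial times the weight, term by term. The partial sums are
  dominated by a constant times \<open>exp (A \<bar>t\<bar>)\<close>, which a Gaussian absorbs.
\<close>

lemma gen_exp_gauss_moment: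
  fixes z :: complex
  assumes \<mu>: "\<mu> > - 1/2"
  defines "C \<equiv> 2 powr (\<mu> + 1/2) * Gamma (\<mu> + 1/2)"
  shows "integrable lebesgue (\<lambda>t. gen_exp \<mu> (z * of_real t) * of_real (t ^ j * gauss_weight \<mu> (1/2) t))"
      (is "integrable _ ?f")
    and "(\<lambda>m. z ^ m / of_real (gen_fact \<mu> m) *
           of_real (C * (gen_fact \<mu> (m + j) * gauss_coeff (1/2) (m + j))))
         sums (LINT t|lebesgue. gen_exp \<mu> (z * of_real t) * of_real (t ^ j * gauss_weight \<mu> (1/2) t))"
proof -
  let ?w = "gauss_weight \<mu> (1/2)"
  let ?s = "\<lambda>N t. (\<Sum>m<N. (z * of_real t) ^ m / of_real (gen_fact \<mu> m)) * of_real (t ^ j * ?w t)"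
  let ?A = "gen_exp_rate \<mu> * norm z + 1"
  let ?b = "\<lambda>t. fact j * (exp (?A * \<bar>t\<bar>) * ?w t)"
  let ?M = "\<lambda>m. C * (gen_fact \<mu> (m + j) * gauss_coeff (1/2) (m + j))"
  have C: "C = Gamma (\<mu> + 1/2) / (1/2) powr (\<mu> + 1/2)"
    by (simp add: C_def powr_divide)
  have mom: "has_bochner_integral lebesgue (\<lambda>t. complex_of_real (t ^ (m + j) * ?w t)) (of_real (?M m))" for m
    using has_bochner_integral_moment[OF \<mu>, of "1/2" "m + j"]
    unfolding C by (intro has_bochner_integral_of_real) simp
  have s_eq: "?s N t = (\<Sum>m<N. z ^ m / of_real (gen_fact \<mu> m) * complex_of_real (t ^ (m + j) * ?w t))" for N t
    unfolding sum_distrib_right by (rule sum.cong) (simp_all add: power_mult_distrib power_add mult_ac)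
  have s_int: "has_bochner_integral lebesgue (?s N) (\<Sum>m<N. z ^ m / of_real (gen_fact \<mu> m) * of_real (?M m))" for N
    unfolding s_eq by (intro has_bochner_integral_sum has_bochner_integral_mult_right mom)
  have s_meas: "?s N \<in> borel_measurable lebesgue" for N
    using s_int[of N] by (rule borel_measurable_has_bochner_integral)
  have lim: "(\<lambda>N. ?s N t) \<longlonglongrightarrow> ?f t" for t
    using gen_exp_sums[OF \<mu>, of "z * of_real t"] unfolding sums_def by (intro tendsto_intros)
  have f_meas: "?f \<in> borel_measurable lebesgue"
    by (rule borel_measurable_LIMSEQ_metric[OF s_meas lim])
  have b_int: "integrable lebesgue ?b"
    by (intro integrable_mult_right integrable_exp_gauss_weight \<mu>) auto
  have bound: "norm (?s N t) \<le> ?b t" for N t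
  proof -
    have "norm (?s N t) = norm (\<Sum>m<N. (z * of_real t) ^ m / of_real (gen_fact \<mu> m)) * (\<bar>t\<bar> ^ j * ?w t)"
      by (simp add: norm_mult norm_power gauss_weight_nonneg del: of_real_mult of_real_power)
        (simp add: abs_mult power_abs gauss_weight_nonneg)
    also have "\<dots> \<le> exp (gen_exp_rate \<mu> * norm (z * of_real t)) * (fact j * exp \<bar>t\<bar> * ?w t)"
      by (intro mult_mono norm_gen_exp_partial_sum_le[OF \<mu>] power_le_fact_exp) (auto simp: gauss_weight_nonneg)
    also have "\<dots> = ?b t"
      by (simp add: norm_mult algebra_simps exp_add)
    finally show ?thesis .
  qed
  show "integrable lebesgue ?f"
    by (rule integrable_dominated_convergence[OF f_meas s_meas b_int AE_I2[OF lim] AE_I2[OF bound]])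
  have "(\<lambda>N. integral\<^sup>L lebesgue (?s N)) \<longlonglongrightarrow> integral\<^sup>L lebesgue ?f"
    by (rule integral_dominated_convergence[OF f_meas s_meas b_int AE_I2[OF lim] AE_I2[OF bound]])
  then show "(\<lambda>m. z ^ m / of_real (gen_fact \<mu> m) * of_real (?M m)) sums integral\<^sup>L lebesgue ?f"
    using s_int by (simp add: sums_def has_bochner_integral_iff)
qed

section \<open>Generalized Hermite functions\<close>

text \<open>
  That is, \<open>H\<^sub>n\<^sup>\<mu>(x) / n!\<close> is the coefficient of \<open>z\<^sup>n\<close> in \<open>exp (- z\<^sup>2) e\<^sub>\<mu>(2xz)\<close>.
\<close>

lemma gen_hermite_conv_gauss_coeff:
  "gen_hermite \<mu> n x = fact n * (\<Sum>j\<le>n. gauss_coeff (-1) (n - j) * (2 * x) ^ j / gen_fact \<mu> j)"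
proof -
  let ?f = "\<lambda>j. gauss_coeff (-1) (n - j) * (2 * x) ^ j / gen_fact \<mu> j"
  have "(\<Sum>j\<le>n. ?f j) = (\<Sum>i\<le>n. ?f (n - i))"
    by (rule sum.reindex_bij_witness[of _ "\<lambda>i. n - i" "\<lambda>j. n - j"]) auto
  also have "\<dots> = (\<Sum>k\<le>n div 2. ?f (n - 2 * k))"
    by (rule sum_even_indices) (simp add: gauss_coeff_odd)
  also have "\<dots> = (\<Sum>k\<le>n div 2. (-1) ^ k * (2 * x) ^ (n - 2 * k) / (fact k * gen_fact \<mu> (n - 2 * k)))"
  proof (rule sum.cong[OF refl])
    fix k assume "k \<in> {..n div 2}"
    then have "n - (n - 2 * k) = 2 * k" by auto
    then show "?f (n - 2 * k) = (-1) ^ k * (2 * x) ^ (n - 2 * k) / (fact k * gen_fact \<mu> (n - 2 * k))"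
      by simp
  qed
  finally show ?thesis by (simp add: gen_hermite_def)
qed

text \<open>
  The constant that normalizes \<open>exp (- x\<^sup>2/2) H\<^sub>n\<^sup>\<mu>(x) / n!\<close> in \<open>L\<^sup>2\<^sub>\<mu>\<close>.
\<close>

definition hermite_norm_factor :: "real \<Rightarrow> nat \<Rightarrow> real" where
  "hermite_norm_factor \<mu> n = sqrt (gen_fact \<mu> n / Gamma (\<mu> + 1/2)) * (1 / (2 powr (real n / 2)))"

lemma hermite_norm_factor_pos:
  assumes "\<mu> > - 1/2"
  shows "hermite_norm_factor \<mu> n > 0"
  using gen_fact_pos[OF assms] Gamma_real_pos[of "\<mu> + 1/2"] assms
  by (simp add: hermite_norm_factor_def)

lemma hermite_norm_factor_square:
  assumes "\<mu> > - 1/2"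
  shows "(hermite_norm_factor \<mu> n)\<^sup>2 = gen_fact \<mu> n / (Gamma (\<mu> + 1/2) * 2 ^ n)"
proof -
  have "(2 powr (real n / 2))\<^sup>2 = (2::real) ^ n"
    by (simp add: powr_realpow power2_eq_square flip: powr_add)
  then show ?thesis
    using gen_fact_pos[OF assms, of n] Gamma_real_pos[of "\<mu> + 1/2"] assms
    by (simp add: hermite_norm_factor_def power_mult_distrib power_divide)
qed

lemma hermite_fun_eq:
  "hermite_fun \<mu> n x = of_real (hermite_norm_factor \<mu> n * exp (- (x\<^sup>2) / 2) *
     (\<Sum>j\<le>n. gauss_coeff (-1) (n - j) * 2 ^ j / gen_fact \<mu> j * x ^ j))"
  by (simp add: hermite_fun_def gen_hermite_conv_gauss_coeff hermite_norm_factor_def power_mult_distrib mult_ac)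

lemma exp_square_sums:
  fixes z :: complex
  shows "(\<lambda>k. z ^ k * of_real (gauss_coeff s k)) sums exp (of_real s * z\<^sup>2)"
proof -
  have "(\<lambda>m. (of_real s * z\<^sup>2) ^ m /\<^sub>R fact m) sums exp (of_real s * z\<^sup>2)"
    by (rule exp_converges)
  moreover have "(of_real s * z\<^sup>2) ^ m /\<^sub>R fact m = z ^ (2 * m) * of_real (gauss_coeff s (2 * m))" for m
    unfolding gauss_coeff_even
    by (simp add: scaleR_conv_of_real power_mult_distrib divide_inverse mult_ac flip: power_mult)
  ultimately have "(\<lambda>m. z ^ (2 * m) * of_real (gauss_coeff s (2 * m))) sums exp (of_real s * z\<^sup>2)"
    by simp
  then show ?thesis
    by (subst (asm) sums_mono_reindex) (auto simp: strict_mono_def gauss_coeff_def elim!: evenE)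
qed

lemma exp_square_sums_shift:
  fixes z :: complex
  shows "(\<lambda>m. if l \<le> m then z ^ m * of_real (gauss_coeff s (m - l)) else 0) sums (z ^ l * exp (of_real s * z\<^sup>2))"
    (is "?f sums _")
proof -
  have "(\<lambda>m. ?f (m + l)) sums (z ^ l * exp (of_real s * z\<^sup>2))"
    using sums_mult[OF exp_square_sums[of z s], of "z ^ l"] by (simp add: power_add mult_ac)
  then show ?thesis
    by (subst (asm) sums_zero_iff_shift) auto
qed

text \<open>
  The left side is, up to a factor \<open>\<sigma>\<^sup>m\<close> and constants, the coefficient of \<open>x\<^sup>m\<close> in the transform of the
  \<open>n\<close>-th Hermite function. After the product formula the sum over \<open>j\<close> becomes the convolution belonging
  to \<open>exp (- z\<^sup>2) exp (2 z\<^sup>2) = exp (z\<^sup>2)\<close>.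
\<close>

lemma hermite_transform_coeff:
  assumes \<mu>: "\<mu> > - 1/2"
  shows "(\<Sum>j\<le>n. gauss_coeff (-1) (n - j) * 2 ^ j / gen_fact \<mu> j *
            (gen_fact \<mu> (m + j) * gauss_coeff (1/2) (m + j) / gen_fact \<mu> m))
       = (\<Sum>l\<le>n. if l \<le> m then gauss_coeff (1/2) (m - l) * (2 ^ l * gauss_coeff 1 (n - l) / gen_fact \<mu> l) else 0)"
proof -
  let ?b = "\<lambda>j. gauss_coeff (-1) (n - j) * 2 ^ j"
  let ?c = "gauss_coeff (1/2)"
  have "(\<Sum>j\<le>n. gauss_coeff (-1) (n - j) * 2 ^ j / gen_fact \<mu> j *
            (gen_fact \<mu> (m + j) * gauss_coeff (1/2) (m + j) / gen_fact \<mu> m))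
      = (\<Sum>j\<le>n. ?b j * (\<Sum>l\<le>min m j. ?c (m - l) * ?c (j - l) / gen_fact \<mu> l))"
    by (simp flip: gen_fact_product_formula[OF \<mu>]) (simp add: mult_ac)
  also have "\<dots> = (\<Sum>j\<le>n. \<Sum>l\<le>n. if l \<le> m \<and> l \<le> j then ?b j * (?c (m - l) * ?c (j - l) / gen_fact \<mu> l) else 0)"
  proof (rule sum.cong[OF refl])
    fix j assume j: "j \<in> {..n}"
    show "?b j * (\<Sum>l\<le>min m j. ?c (m - l) * ?c (j - l) / gen_fact \<mu> l)
        = (\<Sum>l\<le>n. if l \<le> m \<and> l \<le> j then ?b j * (?c (m - l) * ?c (j - l) / gen_fact \<mu> l) else 0)"
      unfolding sum_distrib_left by (rule sum.mono_neutral_cong_left) (use j in auto)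
  qed
  also have "\<dots> = (\<Sum>l\<le>n. \<Sum>j\<le>n. if l \<le> m \<and> l \<le> j then ?b j * (?c (m - l) * ?c (j - l) / gen_fact \<mu> l) else 0)"
    by (rule sum.swap)
  also have "\<dots> = (\<Sum>l\<le>n. if l \<le> m then ?c (m - l) * (2 ^ l * gauss_coeff 1 (n - l) / gen_fact \<mu> l) else 0)"
  proof (rule sum.cong[OF refl])
    fix l assume l: "l \<in> {..n}"
    have "(\<Sum>j\<le>n. if l \<le> j then ?b j * (?c (m - l) * ?c (j - l) / gen_fact \<mu> l) else 0)
        = (\<Sum>j=l..n. ?c (m - l) * 2 ^ l / gen_fact \<mu> l * (gauss_coeff (-1) (n - j) * gauss_coeff 2 (j - l)))"
    proof (rule sum.mono_neutral_cong_right)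
      fix j assume "j \<in> {l..n}"
      then obtain i where j: "j = l + i" by (metis atLeastAtMost_iff le_Suc_ex)
      have "2 ^ i * ?c i = gauss_coeff 2 i"
        by (simp add: gauss_coeff_scale)
      then show "(if l \<le> j then ?b j * (?c (m - l) * ?c (j - l) / gen_fact \<mu> l) else 0)
          = ?c (m - l) * 2 ^ l / gen_fact \<mu> l * (gauss_coeff (-1) (n - j) * gauss_coeff 2 (j - l))"
        by (simp add: j power_add mult_ac)
    qed auto
    also have "\<dots> = ?c (m - l) * 2 ^ l / gen_fact \<mu> l * gauss_coeff 1 (n - l)"
      using l by (subst sum_distrib_left[symmetric], subst gauss_coeff_convolution_from) simp_all
    finally show "(\<Sum>j\<le>n. if l \<le> m \<and> l \<le> j then ?b j * (?c (m - l) * ?c (j - l) / gen_fact \<mu> l) else 0)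
        = (if l \<le> m then ?c (m - l) * (2 ^ l * gauss_coeff 1 (n - l) / gen_fact \<mu> l) else 0)"
      by (simp add: mult_ac)
  qed
  finally show ?thesis .
qed

lemma gauss_coeff_rotate:
  fixes \<sigma> :: complex
  assumes "\<sigma>\<^sup>2 = - 1" "l \<le> n"
  shows "\<sigma> ^ l * of_real (gauss_coeff 1 (n - l)) = \<sigma> ^ n * of_real (gauss_coeff (-1) (n - l))"
proof (cases "even (n - l)")
  case True
  then obtain m where m: "n - l = 2 * m" by (elim evenE)
  then have "n = l + 2 * m" using assms(2) by simp
  moreover have "(- 1) ^ m * (- 1) ^ m = (1::complex)"
    by (simp flip: power_mult_distrib)
  ultimately show ?thesis
    using assms(1) m by (simp add: power_add power_mult)
qed (simp add: gauss_coeff_odd)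

text \<open>
  Both kernels are covered: \<open>\<sigma>\<close> is \<open>-\<i>\<close> for the transform and \<open>\<i>\<close> for its inverse.
\<close>

lemma gft_hermite_fun:
  assumes \<mu>: "\<mu> > - 1/2" and \<sigma>: "\<sigma>\<^sup>2 = - 1"
  shows "integrable lebesgue (gft_integrand \<mu> \<sigma> (hermite_fun \<mu> n) x)"
    and "gft_integral \<mu> \<sigma> (hermite_fun \<mu> n) x = \<sigma> ^ n * hermite_fun \<mu> n x"
proof -
  define C where "C = 2 powr (\<mu> + 1/2) * Gamma (\<mu> + 1/2)"
  have C: "C > 0"
    using \<mu> by (auto simp: C_def intro!: mult_pos_pos Gamma_real_pos)
  define K where "K = hermite_norm_factor \<mu> n"
  define d where "d j = gauss_coeff (-1) (n - j) * 2 ^ j / gen_fact \<mu> j" for j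
  define z where "z = \<sigma> * of_real x"
  let ?I = "\<lambda>j. LINT t|lebesgue. gen_exp \<mu> (z * of_real t) * of_real (t ^ j * gauss_weight \<mu> (1/2) t)"
  have eq: "gft_integrand \<mu> \<sigma> (hermite_fun \<mu> n) x
      = (\<lambda>t. \<Sum>j\<le>n. of_real (K * d j) * (gen_exp \<mu> (z * of_real t) * of_real (t ^ j * gauss_weight \<mu> (1/2) t)))"
    by (simp add: fun_eq_iff gft_integrand_def hermite_fun_eq K_def[symmetric] d_def z_def gauss_weight_def
        sum_distrib_left sum_distrib_right mult_ac)
  note int = gen_exp_gauss_moment(1)[OF \<mu>]
  show "integrable lebesgue (gft_integrand \<mu> \<sigma> (hermite_fun \<mu> n) x)"
    unfolding eq by (intro Bochner_Integration.integrable_sum integrable_mult_right int)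
  have "integral\<^sup>L lebesgue (gft_integrand \<mu> \<sigma> (hermite_fun \<mu> n) x) = (\<Sum>j\<le>n. of_real (K * d j) * ?I j)"
    unfolding eq by (subst Bochner_Integration.integral_sum) (intro integrable_mult_right int, simp)
  also have "\<dots> = of_real (K * C * exp (- (x\<^sup>2) / 2)) *
      (\<Sum>l\<le>n. of_real (2 ^ l * gauss_coeff 1 (n - l) / gen_fact \<mu> l) * z ^ l)"
  proof (rule sums_unique2)
    have "(\<lambda>m. \<Sum>j\<le>n. of_real (K * d j) * (z ^ m / of_real (gen_fact \<mu> m) *
            of_real (C * (gen_fact \<mu> (m + j) * gauss_coeff (1/2) (m + j)))))
          sums (\<Sum>j\<le>n. of_real (K * d j) * ?I j)"
      unfolding C_def by (intro sums_sum sums_mult gen_exp_gauss_moment(2)[OF \<mu>])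
    moreover have "(\<Sum>j\<le>n. of_real (K * d j) * (z ^ m / of_real (gen_fact \<mu> m) *
            of_real (C * (gen_fact \<mu> (m + j) * gauss_coeff (1/2) (m + j)))))
        = of_real (K * C) * (\<Sum>l\<le>n. of_real (2 ^ l * gauss_coeff 1 (n - l) / gen_fact \<mu> l) *
            (if l \<le> m then z ^ m * of_real (gauss_coeff (1/2) (m - l)) else 0))" for m
    proof -
      have "(\<Sum>j\<le>n. of_real (K * d j) * (z ^ m / of_real (gen_fact \<mu> m) *
              of_real (C * (gen_fact \<mu> (m + j) * gauss_coeff (1/2) (m + j)))))
          = of_real (K * C) * z ^ m * of_real (\<Sum>j\<le>n. gauss_coeff (-1) (n - j) * 2 ^ j / gen_fact \<mu> j *
            (gen_fact \<mu> (m + j) * gauss_coeff (1/2) (m + j) / gen_fact \<mu> m))"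
        unfolding of_real_sum sum_distrib_left by (rule sum.cong) (simp_all add: d_def mult_ac)
      then show ?thesis
        unfolding hermite_transform_coeff[OF \<mu>] of_real_sum mult.assoc sum_distrib_left
        by (simp add: mult_ac if_distrib cong: if_cong)
    qed
    ultimately show "(\<lambda>m. of_real (K * C) * (\<Sum>l\<le>n. of_real (2 ^ l * gauss_coeff 1 (n - l) / gen_fact \<mu> l) *
            (if l \<le> m then z ^ m * of_real (gauss_coeff (1/2) (m - l)) else 0)))
        sums (\<Sum>j\<le>n. of_real (K * d j) * ?I j)"
      by simp
    \<comment> \<open>Summation over \<open>m\<close> produces the Gaussian factor \<open>exp (z\<^sup>2/2)\<close>, and \<open>z\<^sup>2 = - x\<^sup>2\<close>.\<close>
    have "(\<lambda>m. of_real (K * C) * (\<Sum>l\<le>n. of_real (2 ^ l * gauss_coeff 1 (n - l) / gen_fact \<mu> l) *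
            (if l \<le> m then z ^ m * of_real (gauss_coeff (1/2) (m - l)) else 0)))
        sums (of_real (K * C) * (\<Sum>l\<le>n. of_real (2 ^ l * gauss_coeff 1 (n - l) / gen_fact \<mu> l) *
            (z ^ l * exp (of_real (1/2) * z\<^sup>2))))"
      by (intro sums_mult sums_sum exp_square_sums_shift)
    moreover have "exp (of_real (1/2) * z\<^sup>2) = of_real (exp (- (x\<^sup>2) / 2))"
      by (simp add: z_def power_mult_distrib \<sigma> flip: exp_of_real)
    ultimately show "(\<lambda>m. of_real (K * C) * (\<Sum>l\<le>n. of_real (2 ^ l * gauss_coeff 1 (n - l) / gen_fact \<mu> l) *
            (if l \<le> m then z ^ m * of_real (gauss_coeff (1/2) (m - l)) else 0)))
        sums (of_real (K * C * exp (- (x\<^sup>2) / 2)) *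
          (\<Sum>l\<le>n. of_real (2 ^ l * gauss_coeff 1 (n - l) / gen_fact \<mu> l) * z ^ l))"
      by (simp add: sum_distrib_left mult_ac)
  qed
  also have "(\<Sum>l\<le>n. of_real (2 ^ l * gauss_coeff 1 (n - l) / gen_fact \<mu> l) * z ^ l)
      = \<sigma> ^ n * of_real (\<Sum>l\<le>n. d l * x ^ l)"
  proof -
    have "of_real (2 ^ l * gauss_coeff 1 (n - l) / gen_fact \<mu> l) * z ^ l = \<sigma> ^ n * of_real (d l * x ^ l)"
      if "l \<le> n" for l
    proof -
      have "of_real (2 ^ l * gauss_coeff 1 (n - l) / gen_fact \<mu> l) * z ^ l
          = (\<sigma> ^ l * of_real (gauss_coeff 1 (n - l))) * of_real (2 ^ l / gen_fact \<mu> l * x ^ l)"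
        by (simp add: z_def power_mult_distrib mult_ac)
      then show ?thesis
        unfolding gauss_coeff_rotate[OF \<sigma> that] by (simp add: d_def mult_ac)
    qed
    then show ?thesis
      by (simp add: sum_distrib_left del: of_real_mult of_real_divide)
  qed
  finally have "integral\<^sup>L lebesgue (gft_integrand \<mu> \<sigma> (hermite_fun \<mu> n) x)
      = of_real C * (\<sigma> ^ n * hermite_fun \<mu> n x)"
    by (simp add: hermite_fun_eq[of \<mu> n x] K_def d_def mult_ac)
  then show "gft_integral \<mu> \<sigma> (hermite_fun \<mu> n) x = \<sigma> ^ n * hermite_fun \<mu> n x"
    using C by (simp add: gft_integral_def flip: C_def)
qed

text \<open>
  Up to constants, the inner product of two Hermite functions. The product formula for \<open>s = 1\<close> splits the
  double sum into two convolutions, each belonging to \<open>exp (- z\<^sup>2) exp (z\<^sup>2) = 1\<close>.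
\<close>

lemma hermite_orthogonality_coeff:
  assumes \<mu>: "\<mu> > - 1/2"
  shows "(\<Sum>i\<le>m. \<Sum>j\<le>n. gauss_coeff (-1) (m - i) * 2 ^ i / gen_fact \<mu> i *
            (gauss_coeff (-1) (n - j) * 2 ^ j / gen_fact \<mu> j) *
            (gen_fact \<mu> (i + j) * gauss_coeff (1/4) (i + j)))
       = (if m = n then 2 ^ n / gen_fact \<mu> n else 0)"
proof -
  let ?b = "gauss_coeff (-1)" and ?c = "gauss_coeff 1"
  have inv: "(\<Sum>i\<le>k. if l \<le> i then ?b (k - i) * ?c (i - l) else 0) = (if k = l then 1 else 0)" for k l
  proof (cases "l \<le> k")
    case True
    have "(\<Sum>i\<le>k. if l \<le> i then ?b (k - i) * ?c (i - l) else 0) = (\<Sum>i=l..k. ?b (k - i) * ?c (i - l))"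
      by (rule sum.mono_neutral_cong_right) auto
    also have "\<dots> = (if k = l then 1 else 0)"
      using True by (simp add: gauss_coeff_convolution_from gauss_coeff_0_left)
    finally show ?thesis .
  next
    case False
    then show ?thesis by (auto intro!: sum.neutral)
  qed
  have "(\<Sum>i\<le>m. \<Sum>j\<le>n. ?b (m - i) * 2 ^ i / gen_fact \<mu> i * (?b (n - j) * 2 ^ j / gen_fact \<mu> j) *
            (gen_fact \<mu> (i + j) * gauss_coeff (1/4) (i + j)))
      = (\<Sum>i\<le>m. \<Sum>j\<le>n. \<Sum>l\<le>m. (if l \<le> i then ?b (m - i) * ?c (i - l) else 0) *
            (if l \<le> j then ?b (n - j) * ?c (j - l) else 0) * (2 ^ l / gen_fact \<mu> l))"
  proof (intro sum.cong refl)
    fix i j assume ij: "i \<in> {..m}" "j \<in> {..n}"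
    have "?b (m - i) * 2 ^ i / gen_fact \<mu> i * (?b (n - j) * 2 ^ j / gen_fact \<mu> j) *
            (gen_fact \<mu> (i + j) * gauss_coeff (1/4) (i + j))
        = ?b (m - i) * ?b (n - j) * (gen_fact \<mu> (i + j) * (2 ^ (i + j) * gauss_coeff (1/4) (i + j))
             / (gen_fact \<mu> i * gen_fact \<mu> j))"
      by (simp add: power_add mult_ac)
    also have "2 ^ (i + j) * gauss_coeff (1/4) (i + j) = ?c (i + j)"
      by (simp add: gauss_coeff_scale)
    also have "?b (m - i) * ?b (n - j) * (gen_fact \<mu> (i + j) * ?c (i + j) / (gen_fact \<mu> i * gen_fact \<mu> j))
        = (\<Sum>l\<le>min i j. ?b (m - i) * ?b (n - j) * (2 ^ l * ?c (i - l) * ?c (j - l) / gen_fact \<mu> l))"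
      by (simp add: gen_fact_product_formula_scaled[OF \<mu>] sum_distrib_left)
    also have "\<dots> = (\<Sum>l\<le>m. (if l \<le> i then ?b (m - i) * ?c (i - l) else 0) *
            (if l \<le> j then ?b (n - j) * ?c (j - l) else 0) * (2 ^ l / gen_fact \<mu> l))"
      by (rule sum.mono_neutral_cong_left) (use ij in auto)
    finally show "?b (m - i) * 2 ^ i / gen_fact \<mu> i * (?b (n - j) * 2 ^ j / gen_fact \<mu> j) *
            (gen_fact \<mu> (i + j) * gauss_coeff (1/4) (i + j))
        = (\<Sum>l\<le>m. (if l \<le> i then ?b (m - i) * ?c (i - l) else 0) *
            (if l \<le> j then ?b (n - j) * ?c (j - l) else 0) * (2 ^ l / gen_fact \<mu> l))" .
  qed
  also have "\<dots> = (\<Sum>i\<le>m. \<Sum>l\<le>m. \<Sum>j\<le>n. (if l \<le> i then ?b (m - i) * ?c (i - l) else 0) *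
            (if l \<le> j then ?b (n - j) * ?c (j - l) else 0) * (2 ^ l / gen_fact \<mu> l))"
    by (rule sum.cong[OF refl], rule sum.swap)
  also have "\<dots> = (\<Sum>l\<le>m. \<Sum>i\<le>m. \<Sum>j\<le>n. (if l \<le> i then ?b (m - i) * ?c (i - l) else 0) *
            (if l \<le> j then ?b (n - j) * ?c (j - l) else 0) * (2 ^ l / gen_fact \<mu> l))"
    by (rule sum.swap)
  also have "\<dots> = (\<Sum>l\<le>m. (\<Sum>i\<le>m. if l \<le> i then ?b (m - i) * ?c (i - l) else 0) *
            (\<Sum>j\<le>n. if l \<le> j then ?b (n - j) * ?c (j - l) else 0) * (2 ^ l / gen_fact \<mu> l))"
    unfolding sum_product unfolding sum_distrib_right ..
  also have "\<dots> = (\<Sum>l\<le>m. if l = m then if m = n then 2 ^ n / gen_fact \<mu> n else 0 else 0)"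
    unfolding inv by (rule sum.cong) auto
  also have "\<dots> = (if m = n then 2 ^ n / gen_fact \<mu> n else 0)"
    by simp
  finally show ?thesis .
qed

lemma hermite_fun_measurable [measurable]: "hermite_fun \<mu> n \<in> borel_measurable borel"
  unfolding hermite_fun_def gen_hermite_def by measurable

lemma hermite_fun_measurable_lebesgue [measurable]: "hermite_fun \<mu> n \<in> borel_measurable lebesgue"
  by (rule measurable_completion) measurable

lemma cnj_hermite_fun [simp]: "cnj (hermite_fun \<mu> n t) = hermite_fun \<mu> n t"
  by (simp add: hermite_fun_def)

lemma has_bochner_integral_hermite_fun:
  assumes \<mu>: "\<mu> > - 1/2"
  shows "has_bochner_integral lebesgue
    (\<lambda>t. hermite_fun \<mu> m t * cnj (hermite_fun \<mu> n t) * of_real (\<bar>t\<bar> powr (2 * \<mu>))) (if m = n then 1 else 0)"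
proof -
  define K where "K = hermite_norm_factor \<mu>"
  define d where "d n j = gauss_coeff (-1) (n - j) * 2 ^ j / gen_fact \<mu> j" for n j
  let ?G = "Gamma (\<mu> + 1/2)"
  have G: "?G > 0"
    using \<mu> by (intro Gamma_real_pos) simp
  have eq: "hermite_fun \<mu> m t * cnj (hermite_fun \<mu> n t) * of_real (\<bar>t\<bar> powr (2 * \<mu>))
      = of_real (\<Sum>i\<le>m. \<Sum>j\<le>n. K m * K n * (d m i * d n j) * (t ^ (i + j) * gauss_weight \<mu> 1 t))" for t
  proof -
    have "exp (- t\<^sup>2) = exp (- (t\<^sup>2) / 2) * exp (- (t\<^sup>2) / 2)"
      by (simp flip: exp_add)
    then have "(\<Sum>i\<le>m. \<Sum>j\<le>n. K m * K n * (d m i * d n j) * (t ^ (i + j) * gauss_weight \<mu> 1 t))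
        = (\<Sum>i\<le>m. \<Sum>j\<le>n. (d m i * t ^ i) * (d n j * t ^ j)) *
          (K m * K n * exp (- (t\<^sup>2) / 2) * exp (- (t\<^sup>2) / 2) * \<bar>t\<bar> powr (2 * \<mu>))"
      by (simp add: gauss_weight_def power_add mult_ac sum_distrib_left sum_distrib_right)
    also have "\<dots> = (K m * exp (- (t\<^sup>2) / 2) * (\<Sum>i\<le>m. d m i * t ^ i)) *
        (K n * exp (- (t\<^sup>2) / 2) * (\<Sum>j\<le>n. d n j * t ^ j)) * \<bar>t\<bar> powr (2 * \<mu>)"
      unfolding sum_product[symmetric] by (simp add: mult_ac)
    finally show ?thesis
      unfolding cnj_hermite_fun hermite_fun_eq by (simp add: K_def d_def)
  qed
  have "has_bochner_integral lebesgue
     (\<lambda>t. \<Sum>i\<le>m. \<Sum>j\<le>n. K m * K n * (d m i * d n j) * (t ^ (i + j) * gauss_weight \<mu> 1 t))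
     (\<Sum>i\<le>m. \<Sum>j\<le>n. K m * K n * (d m i * d n j) * (?G * (gen_fact \<mu> (i + j) * gauss_coeff (1/4) (i + j))))"
    using has_bochner_integral_moment[OF \<mu>, of 1]
    by (intro has_bochner_integral_sum has_bochner_integral_mult_right) simp
  also have "(\<Sum>i\<le>m. \<Sum>j\<le>n. K m * K n * (d m i * d n j) * (?G * (gen_fact \<mu> (i + j) * gauss_coeff (1/4) (i + j))))
      = K m * K n * ?G * (\<Sum>i\<le>m. \<Sum>j\<le>n. d m i * d n j * (gen_fact \<mu> (i + j) * gauss_coeff (1/4) (i + j)))"
    by (simp add: sum_distrib_left mult_ac)
  also have "\<dots> = K m * K n * ?G * (if m = n then 2 ^ n / gen_fact \<mu> n else 0)"
    unfolding d_def hermite_orthogonality_coeff[OF \<mu>] ..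
  also have "\<dots> = (if m = n then 1 else 0)"
    using hermite_norm_factor_square[OF \<mu>, of n] G gen_fact_pos[OF \<mu>, of n]
    by (auto simp: K_def power2_eq_square)
  finally have "has_bochner_integral lebesgue
     (\<lambda>t. \<Sum>i\<le>m. \<Sum>j\<le>n. K m * K n * (d m i * d n j) * (t ^ (i + j) * gauss_weight \<mu> 1 t))
     (if m = n then 1 else 0)" .
  from has_bochner_integral_of_real[OF this, where 'a = complex] show ?thesis
    unfolding eq by (simp add: if_distrib cong: if_cong)
qed

lemma hermite_fun_in_L2_fun:
  assumes "\<mu> > - 1/2"
  shows "hermite_fun \<mu> n \<in> L2_fun \<mu>"
proof -
  have "integrable lebesgue
      (\<lambda>t. hermite_fun \<mu> n t * cnj (hermite_fun \<mu> n t) * of_real (\<bar>t\<bar> powr (2 * \<mu>)))"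
    using has_bochner_integral_hermite_fun[OF assms, of n n] by (auto simp: has_bochner_integral_iff)
  then have "integrable lebesgue
      (\<lambda>t. norm (hermite_fun \<mu> n t * cnj (hermite_fun \<mu> n t) * of_real (\<bar>t\<bar> powr (2 * \<mu>))))"
    by (rule integrable_norm)
  then show ?thesis
    by (simp add: L2_fun_def norm_mult power2_eq_square)
qed

section \<open>Totality of the Hermite functions\<close>

text \<open>
  A real function with finite exponential moments and vanishing moments is zero almost everywhere: unless
  its positive and negative parts vanish, they are, up to a common factor, densities of probability
  distributions with the same characteristic function.
\<close>

lemma AE_zero_if_moments_zero_lborel:
  fixes h :: "real \<Rightarrow> real"
  assumes [measurable]: "h \<in> borel_measurable borel"
    and exp_int: "\<And>A. integrable lborel (\<lambda>t. exp (A * \<bar>t\<bar>) * h t)"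
    and moments: "\<And>n. (LINT t|lborel. t ^ n * h t) = 0"
  shows "AE t in lborel. h t = 0"
proof -
  have exp_int': "integrable lborel (\<lambda>t. exp (A * \<bar>t\<bar>) * \<bar>h t\<bar>)" for A
    using integrable_abs[OF exp_int[of A]] by (simp add: abs_mult)
  have h_int: "integrable lborel h"
    using exp_int[of 0] by simp
  have mom_int: "integrable lborel (\<lambda>t. t ^ n * h t)" for n
  proof (rule Bochner_Integration.integrable_bound)
    show "integrable lborel (\<lambda>t. fact n * (exp (1 * \<bar>t\<bar>) * \<bar>h t\<bar>))"
      by (intro integrable_mult_right exp_int')
    have "\<bar>t ^ n * h t\<bar> \<le> \<bar>fact n * (exp (1 * \<bar>t\<bar>) * \<bar>h t\<bar>)\<bar>" for t
      using mult_right_mono[OF power_le_fact_exp[of "\<bar>t\<bar>" n], of "\<bar>h t\<bar>"]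
      by (simp add: abs_mult power_abs mult_ac)
    then show "AE t in lborel. norm (t ^ n * h t) \<le> norm (fact n * (exp (1 * \<bar>t\<bar>) * \<bar>h t\<bar>))"
      by simp
  qed simp
  define hp where "hp t = max 0 (h t)" for t
  define hn where "hn t = max 0 (- h t)" for t
  define c where "c = (LINT t|lborel. hp t)"
  have h_eq: "h t = hp t - hn t" for t
    by (simp add: hp_def hn_def max_def)
  have [measurable]: "hp \<in> borel_measurable borel" "hn \<in> borel_measurable borel"
    unfolding hp_def[abs_def] hn_def[abs_def] by measurable
  have hp_int: "integrable lborel hp" and hn_int: "integrable lborel hn"
    unfolding hp_def[abs_def] hn_def[abs_def] using h_int by (auto intro!: integrable_max)
  have nonneg: "0 \<le> hp t" "0 \<le> hn t" for t
    by (simp_all add: hp_def hn_def)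
  have c': "(LINT t|lborel. hn t) = c"
    using moments[of 0] hp_int hn_int by (simp add: h_eq c_def)
  have c_nonneg: "0 \<le> c"
    unfolding c_def using nonneg by (intro integral_nonneg_AE) auto
  have fourier: "(LINT t|lborel. iexp (s * t) * of_real (h t)) = 0" for s
  proof -
    let ?S = "\<lambda>N t. (\<Sum>k<N. (\<i> * of_real (s * t)) ^ k / fact k) * of_real (h t)"
    have "(\<lambda>N. integral\<^sup>L lborel (?S N)) \<longlonglongrightarrow> (LINT t|lborel. iexp (s * t) * of_real (h t))"
    proof (rule integral_dominated_convergence[where w = "\<lambda>t. exp (\<bar>s\<bar> * \<bar>t\<bar>) * \<bar>h t\<bar>"])
      show "AE t in lborel. (\<lambda>N. ?S N t) \<longlonglongrightarrow> iexp (s * t) * of_real (h t)"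
      proof (rule AE_I2)
        fix t
        have "(\<lambda>k. (\<i> * of_real (s * t)) ^ k /\<^sub>R fact k) sums iexp (s * t)"
          by (rule exp_converges)
        then have "(\<lambda>k. (\<i> * of_real (s * t)) ^ k / fact k) sums iexp (s * t)"
          by (simp add: scaleR_conv_of_real divide_inverse mult_ac)
        then show "(\<lambda>N. ?S N t) \<longlonglongrightarrow> iexp (s * t) * of_real (h t)"
          unfolding sums_def by (intro tendsto_intros)
      qed
      show "AE t in lborel. norm (?S N t) \<le> exp (\<bar>s\<bar> * \<bar>t\<bar>) * \<bar>h t\<bar>" for N
      proof (rule AE_I2)
        fix t
        have "norm (\<Sum>k<N. (\<i> * of_real (s * t)) ^ k / fact k) \<le> (\<Sum>k<N. (\<bar>s\<bar> * \<bar>t\<bar>) ^ k / fact k)"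
          by (rule sum_norm_le) (simp add: norm_divide norm_power norm_mult abs_mult)
        also have "\<dots> \<le> exp (\<bar>s\<bar> * \<bar>t\<bar>)"
          by (rule exp_partial_sum_le) simp
        finally show "norm (?S N t) \<le> exp (\<bar>s\<bar> * \<bar>t\<bar>) * \<bar>h t\<bar>"
          unfolding norm_mult by (intro mult_mono) auto
      qed
    qed (use exp_int' in measurable)
    moreover have "integral\<^sup>L lborel (?S N) = 0" for N
    proof -
      have "?S N = (\<lambda>t. \<Sum>k<N. (\<i> * of_real s) ^ k / fact k * complex_of_real (t ^ k * h t))"
        unfolding sum_distrib_right by (intro ext sum.cong) (simp_all add: power_mult_distrib mult_ac)
      then show ?thesis
        by (simp add: mom_int moments integral_complex_of_real integrable_of_real
            del: of_real_mult of_real_power)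
    qed
    ultimately show ?thesis
      by (simp add: LIMSEQ_const_iff)
  qed
  show ?thesis
  proof (cases "c = 0")
    case True
    then have "AE t in lborel. hp t = 0" "AE t in lborel. hn t = 0"
      using integral_nonneg_eq_0_iff_AE[OF hp_int] integral_nonneg_eq_0_iff_AE[OF hn_int] nonneg c' c_def
      by auto
    then show ?thesis
      by eventually_elim (simp add: h_eq)
  next
    case False
    with c_nonneg have c: "c > 0" by simp
    have distr: "real_distribution (density lborel (\<lambda>t. ennreal (g t / c)))"
      and char: "char (density lborel (\<lambda>t. ennreal (g t / c))) s
          = (LINT t|lborel. iexp (s * t) * of_real (g t)) / c"
      if [measurable]: "g \<in> borel_measurable borel" and g: "\<And>t. 0 \<le> g t" "integrable lborel g"
        "integral\<^sup>L lborel g = c" for g s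
    proof -
      have "(\<integral>\<^sup>+t. ennreal (g t / c) \<partial>lborel) = ennreal (LINT t|lborel. g t / c)"
        using g c by (intro nn_integral_eq_integral) auto
      also have "\<dots> = 1"
        using g c by simp
      finally show "real_distribution (density lborel (\<lambda>t. ennreal (g t / c)))"
        by (auto simp: real_distribution_def real_distribution_axioms_def emeasure_density intro!: prob_spaceI)
      have "char (density lborel (\<lambda>t. ennreal (g t / c))) s = (LINT t|lborel. (g t / c) *\<^sub>R iexp (s * t))"
        unfolding char_def using g c by (intro integral_density) auto
      also have "\<dots> = (LINT t|lborel. iexp (s * t) * of_real (g t) / c)"
        by (simp add: scaleR_conv_of_real mult_ac)
      finally show "char (density lborel (\<lambda>t. ennreal (g t / c))) s
          = (LINT t|lborel. iexp (s * t) * of_real (g t)) / c"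
        by simp
    qed
    have iexp_int: "integrable lborel (\<lambda>t. iexp (s * t) * of_real (g t))"
      if [measurable]: "g \<in> borel_measurable borel" and g: "integrable lborel g" for g s
      using g by (rule Bochner_Integration.integrable_bound) (auto simp: norm_mult)
    have "char (density lborel (\<lambda>t. ennreal (hp t / c))) = char (density lborel (\<lambda>t. ennreal (hn t / c)))"
    proof (rule ext)
      fix s
      have "(LINT t|lborel. iexp (s * t) * of_real (hp t)) - (LINT t|lborel. iexp (s * t) * of_real (hn t)) = 0"
        using fourier[of s] iexp_int[of hp s] iexp_int[of hn s] hp_int hn_int
        by (simp add: h_eq algebra_simps)
      then show "char (density lborel (\<lambda>t. ennreal (hp t / c))) s = char (density lborel (\<lambda>t. ennreal (hn t / c))) s"
        using char[of hp s] char[of hn s] nonneg hp_int hn_int c' c_def[symmetric] by simp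
    qed
    then have "density lborel (\<lambda>t. ennreal (hp t / c)) = density lborel (\<lambda>t. ennreal (hn t / c))"
      using nonneg hp_int hn_int c' c_def by (intro Levy_uniqueness distr) auto
    then have "AE t in lborel. ennreal (hp t / c) = ennreal (hn t / c)"
      by (subst (asm) sigma_finite_measure.density_unique_iff[OF sigma_finite_lborel]) auto
    then show ?thesis
    proof eventually_elim
      case (elim t)
      then show ?case
        using c nonneg[of t] by (simp add: h_eq)
    qed
  qed
qed

text \<open>
  The characteristic function argument needs Borel densities, whereas the elements of \<open>L\<^sup>2\<^sub>\<mu>\<close> are only
  Lebesgue measurable.
\<close>

lemma AE_zero_if_moments_zero:
  fixes h :: "real \<Rightarrow> real"
  assumes h: "h \<in> borel_measurable lebesgue"
    and exp_int: "\<And>A. integrable lebesgue (\<lambda>t. exp (A * \<bar>t\<bar>) * h t)"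
    and moments: "\<And>n. (LINT t|lebesgue. t ^ n * h t) = 0"
  shows "AE t in lebesgue. h t = 0"
proof -
  obtain g where [measurable]: "g \<in> borel_measurable borel" and ae: "AE t in lborel. h t = g t"
    using completion_ex_borel_measurable_real[OF h] by auto
  have ae': "AE t in lebesgue. h t = g t"
    by (rule AE_completion[OF ae])
  have "AE t in lborel. g t = 0"
  proof (rule AE_zero_if_moments_zero_lborel)
    fix A
    have "AE t in lebesgue. exp (A * \<bar>t\<bar>) * h t = exp (A * \<bar>t\<bar>) * g t"
      using ae' by eventually_elim simp
    then have "integrable lebesgue (\<lambda>t. exp (A * \<bar>t\<bar>) * g t)"
      using exp_int[of A] by (simp only: integrable_lebesgue_cong_AE)
    then show "integrable lborel (\<lambda>t. exp (A * \<bar>t\<bar>) * g t)"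
      by (subst (asm) integrable_completion) auto
  next
    fix n
    have "AE t in lebesgue. t ^ n * h t = t ^ n * g t"
      using ae' by eventually_elim simp
    then have "(LINT t|lebesgue. t ^ n * g t) = 0"
      using moments[of n] by (simp only: integral_lebesgue_cong_AE)
    then show "(LINT t|lborel. t ^ n * g t) = 0"
      by (subst (asm) integral_completion) auto
  qed simp
  then have "AE t in lebesgue. g t = 0"
    by (rule AE_completion)
  with ae' show ?thesis by eventually_elim simp
qed

lemma integrable_exp_times_L2_fun:
  assumes \<mu>: "\<mu> > - 1/2" and f: "f \<in> L2_fun \<mu>"
  shows "integrable lebesgue (\<lambda>t. of_real (exp (A * \<bar>t\<bar>)) * (f t * of_real (gauss_weight \<mu> (1/2) t)))"
proof (rule Bochner_Integration.integrable_bound)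
  have [measurable]: "f \<in> borel_measurable lebesgue"
    using f by (simp add: L2_fun_def)
  show "integrable lebesgue (\<lambda>t. (cmod (f t))\<^sup>2 * \<bar>t\<bar> powr (2 * \<mu>) + exp (2 * A * \<bar>t\<bar>) * gauss_weight \<mu> 1 t)"
    using f by (intro Bochner_Integration.integrable_add integrable_exp_gauss_weight \<mu>) (auto simp: L2_fun_def)
  have "(\<lambda>t. complex_of_real (exp (A * \<bar>t\<bar>))) \<in> borel_measurable lebesgue"
    by (rule measurable_completion) measurable
  then show "(\<lambda>t. of_real (exp (A * \<bar>t\<bar>)) * (f t * of_real (gauss_weight \<mu> (1/2) t))) \<in> borel_measurable lebesgue"
    by measurable
  show "AE t in lebesgue. norm (of_real (exp (A * \<bar>t\<bar>)) * (f t * of_real (gauss_weight \<mu> (1/2) t)))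
      \<le> norm ((cmod (f t))\<^sup>2 * \<bar>t\<bar> powr (2 * \<mu>) + exp (2 * A * \<bar>t\<bar>) * gauss_weight \<mu> 1 t)"
  proof (rule AE_I2)
    fix t
    define u where "u = exp (A * \<bar>t\<bar>) * exp (- (t\<^sup>2 / 2))"
    have u2: "u\<^sup>2 = exp (2 * A * \<bar>t\<bar>) * exp (- t\<^sup>2)"
      by (simp add: u_def power2_eq_square flip: exp_add)
    have "2 * (cmod (f t) * u) \<le> (cmod (f t))\<^sup>2 + u\<^sup>2"
      using sum_squares_bound[of "cmod (f t)" u] by simp
    moreover have "0 \<le> cmod (f t) * u"
      by (simp add: u_def)
    ultimately have "cmod (f t) * u * \<bar>t\<bar> powr (2 * \<mu>) \<le> ((cmod (f t))\<^sup>2 + u\<^sup>2) * \<bar>t\<bar> powr (2 * \<mu>)"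
      by (intro mult_right_mono) auto
    then show "norm (of_real (exp (A * \<bar>t\<bar>)) * (f t * of_real (gauss_weight \<mu> (1/2) t)))
      \<le> norm ((cmod (f t))\<^sup>2 * \<bar>t\<bar> powr (2 * \<mu>) + exp (2 * A * \<bar>t\<bar>) * gauss_weight \<mu> 1 t)"
      unfolding u2 by (simp add: norm_mult gauss_weight_def u_def algebra_simps)
  qed
qed

text \<open>
  Since the leading coefficients do not vanish, orthogonality to the Hermite functions passes by induction
  to all \<open>t\<^sup>n exp (- t\<^sup>2/2)\<close>, so all moments of \<open>f(t) exp (- t\<^sup>2/2) \<bar>t\<bar>\<^sup>2\<^sup>\<mu>\<close> are zero.
\<close>

lemma hermite_fun_total:
  assumes \<mu>: "\<mu> > - 1/2" and f: "f \<in> L2_fun \<mu>"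
    and orth: "\<And>n. (LINT t|lebesgue. f t * cnj (hermite_fun \<mu> n t) * of_real (\<bar>t\<bar> powr (2 * \<mu>))) = 0"
  shows "AE t in lebesgue. f t = 0"
proof -
  let ?h = "\<lambda>t. f t * of_real (gauss_weight \<mu> (1/2) t)"
  have [measurable]: "f \<in> borel_measurable lebesgue"
    using f by (simp add: L2_fun_def)
  note exp_int = integrable_exp_times_L2_fun[OF \<mu> f]
  have mom_int: "integrable lebesgue (\<lambda>t. of_real (t ^ n) * ?h t)" for n
  proof (rule Bochner_Integration.integrable_bound)
    show "integrable lebesgue (\<lambda>t. of_real (fact n) * (of_real (exp (1 * \<bar>t\<bar>)) * ?h t))"
      by (intro integrable_mult_right exp_int)
    have "(\<lambda>t. complex_of_real (t ^ n)) \<in> borel_measurable lebesgue"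
      by (rule measurable_completion) measurable
    then show "(\<lambda>t. of_real (t ^ n) * ?h t) \<in> borel_measurable lebesgue"
      by measurable
    have "\<bar>t ^ n\<bar> * cmod (?h t) \<le> fact n * exp \<bar>t\<bar> * cmod (?h t)" for t
      by (intro mult_right_mono) (simp_all add: power_abs power_le_fact_exp)
    then show "AE t in lebesgue. norm (of_real (t ^ n) * ?h t)
        \<le> norm (of_real (fact n) * (of_real (exp (1 * \<bar>t\<bar>)) * ?h t))"
      by (intro AE_I2) (simp add: norm_mult norm_power power_abs mult.assoc del: of_real_fact)
  qed
  have moments: "(LINT t|lebesgue. of_real (t ^ n) * ?h t) = 0" for n
  proof (induction n rule: less_induct)
    case (less n)
    define d where "d j = gauss_coeff (-1) (n - j) * 2 ^ j / gen_fact \<mu> j" for j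
    have "0 = (LINT t|lebesgue. f t * cnj (hermite_fun \<mu> n t) * of_real (\<bar>t\<bar> powr (2 * \<mu>)))"
      by (simp only: orth)
    also have "\<dots> = (LINT t|lebesgue. (\<Sum>j\<le>n. of_real (hermite_norm_factor \<mu> n * d j) * (of_real (t ^ j) * ?h t)))"
      by (intro Bochner_Integration.integral_cong refl)
        (simp only: cnj_hermite_fun,
         simp add: hermite_fun_eq d_def gauss_weight_def sum_distrib_left sum_distrib_right mult_ac)
    also have "\<dots> = (\<Sum>j\<le>n. of_real (hermite_norm_factor \<mu> n * d j) * (LINT t|lebesgue. of_real (t ^ j) * ?h t))"
      by (subst Bochner_Integration.integral_sum) (intro integrable_mult_right mom_int, simp)
    also have "\<dots> = of_real (hermite_norm_factor \<mu> n * d n) * (LINT t|lebesgue. of_real (t ^ n) * ?h t)"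
      by (subst sum.remove[of _ n]) (auto simp: less.IH simp del: of_real_power intro!: sum.neutral)
    finally show ?case
      using hermite_norm_factor_pos[OF \<mu>, of n] gen_fact_pos[OF \<mu>, of n]
      by (auto simp: d_def simp del: of_real_power)
  qed
  have "AE t in lebesgue. Re (?h t) = 0"
  proof (rule AE_zero_if_moments_zero)
    show "(\<lambda>t. Re (?h t)) \<in> borel_measurable lebesgue" by measurable
    show "integrable lebesgue (\<lambda>t. exp (A * \<bar>t\<bar>) * Re (?h t))" for A
      using integrable_Re[OF exp_int[of A]] by simp
    show "(LINT t|lebesgue. t ^ n * Re (?h t)) = 0" for n
      using integral_Re[OF mom_int[of n]] moments[of n] by (simp flip: of_real_power)
  qed
  moreover have "AE t in lebesgue. Im (?h t) = 0"
  proof (rule AE_zero_if_moments_zero)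
    show "(\<lambda>t. Im (?h t)) \<in> borel_measurable lebesgue" by measurable
    show "integrable lebesgue (\<lambda>t. exp (A * \<bar>t\<bar>) * Im (?h t))" for A
      using integrable_Im[OF exp_int[of A]] by simp
    show "(LINT t|lebesgue. t ^ n * Im (?h t)) = 0" for n
      using integral_Im[OF mom_int[of n]] moments[of n] by (simp flip: of_real_power)
  qed
  moreover have "AE t in lebesgue. t \<noteq> (0::real)"
    by (rule AE_completion) (rule AE_lborel_singleton)
  ultimately show ?thesis
  proof eventually_elim
    case (elim t)
    then show ?case by (simp add: gauss_weight_def complex_eq_iff)
  qed
qed

section \<open>Inner product and completeness of the L2 space\<close>

lemma abs_powr_measurable_lebesgue [measurable]:
  "(\<lambda>t::real. \<bar>t\<bar> powr a) \<in> borel_measurable lebesgue"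
  by (rule measurable_completion) measurable

lemma L2_inner_integrable:
  assumes "f \<in> L2_fun \<mu>" "g \<in> L2_fun \<mu>"
  shows "integrable lebesgue (\<lambda>t. f t * cnj (g t) * complex_of_real (\<bar>t\<bar> powr (2 * \<mu>)))"
proof (rule Bochner_Integration.integrable_bound)
  show "integrable lebesgue (\<lambda>t. (cmod (f t))\<^sup>2 * \<bar>t\<bar> powr (2 * \<mu>) + (cmod (g t))\<^sup>2 * \<bar>t\<bar> powr (2 * \<mu>))"
    using assms by (auto simp: L2_fun_def)
  have [measurable]: "f \<in> borel_measurable lebesgue" "g \<in> borel_measurable lebesgue"
    using assms by (auto simp: L2_fun_def)
  have "(\<lambda>t. cnj (g t)) \<in> borel_measurable lebesgue"
    by (rule measurable_compose[of g _ borel]) (auto intro!: borel_measurable_continuous_onI continuous_intros)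
  moreover have "(\<lambda>t. complex_of_real (\<bar>t\<bar> powr (2 * \<mu>))) \<in> borel_measurable lebesgue"
    by (rule measurable_completion) measurable
  ultimately show "(\<lambda>t. f t * cnj (g t) * complex_of_real (\<bar>t\<bar> powr (2 * \<mu>))) \<in> borel_measurable lebesgue"
    by (intro borel_measurable_times) simp_all
  show "AE t in lebesgue. norm (f t * cnj (g t) * complex_of_real (\<bar>t\<bar> powr (2 * \<mu>)))
     \<le> norm ((cmod (f t))\<^sup>2 * \<bar>t\<bar> powr (2 * \<mu>) + (cmod (g t))\<^sup>2 * \<bar>t\<bar> powr (2 * \<mu>))"
  proof (rule AE_I2)
    fix t
    have "cmod (f t) * cmod (g t) \<le> (cmod (f t))\<^sup>2 + (cmod (g t))\<^sup>2"
    proof -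
      have "0 \<le> cmod (f t) * cmod (g t)" by simp
      with sum_squares_bound[of "cmod (f t)" "cmod (g t)"] show ?thesis by linarith
    qed
    then have "cmod (f t) * cmod (g t) * \<bar>t\<bar> powr (2 * \<mu>) \<le> ((cmod (f t))\<^sup>2 + (cmod (g t))\<^sup>2) * \<bar>t\<bar> powr (2 * \<mu>)"
      by (rule mult_right_mono) simp
    then show "norm (f t * cnj (g t) * complex_of_real (\<bar>t\<bar> powr (2 * \<mu>)))
       \<le> norm ((cmod (f t))\<^sup>2 * \<bar>t\<bar> powr (2 * \<mu>) + (cmod (g t))\<^sup>2 * \<bar>t\<bar> powr (2 * \<mu>))"
      by (simp add: norm_mult algebra_simps)
  qed
qed

lemma L2_inner_add_left:
  assumes "X \<in> L2 \<mu>" "Y \<in> L2 \<mu>" "Z \<in> L2 \<mu>"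
  shows "L2_inner \<mu> (X + Y) Z = L2_inner \<mu> X Z + L2_inner \<mu> Y Z"
proof -
  obtain f g h where fgh: "X = abs_aefun f" "Y = abs_aefun g" "Z = abs_aefun h"
    "f \<in> L2_fun \<mu>" "g \<in> L2_fun \<mu>" "h \<in> L2_fun \<mu>"
    using assms by (auto simp: L2_def)
  then show ?thesis
    using L2_inner_integrable[of f \<mu> h] L2_inner_integrable[of g \<mu> h]
    by (simp add: plus_aefun.abs_eq L2_inner.abs_eq distrib_right)
qed

lemma L2_inner_scale_left: "L2_inner \<mu> (scale_aefun c X) Y = c * L2_inner \<mu> X Y"
  by transfer (simp add: mult.assoc)

lemma L2_inner_cnj: "L2_inner \<mu> Y X = cnj (L2_inner \<mu> X Y)"
proof transfer
  fix \<mu> and g f :: "real \<Rightarrow> complex"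
  have "(LINT t|lebesgue. g t * cnj (f t) * of_real (\<bar>t\<bar> powr (2 * \<mu>)))
      = (LINT t|lebesgue. cnj (f t * cnj (g t) * of_real (\<bar>t\<bar> powr (2 * \<mu>))))"
    by (simp add: mult_ac)
  then show "(LINT t|lebesgue. g t * cnj (f t) * of_real (\<bar>t\<bar> powr (2 * \<mu>)))
      = cnj (LINT t|lebesgue. f t * cnj (g t) * of_real (\<bar>t\<bar> powr (2 * \<mu>)))"
    by (simp only: Bochner_Integration.integral_cnj)
qed

lemma L2_inner_self: "L2_inner \<mu> X X = of_real ((L2_norm \<mu> X)\<^sup>2)"
proof transfer
  fix \<mu> and f :: "real \<Rightarrow> complex"
  have "(LINT t|lebesgue. f t * cnj (f t) * of_real (\<bar>t\<bar> powr (2 * \<mu>)))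
      = (LINT t|lebesgue. complex_of_real ((cmod (f t))\<^sup>2 * \<bar>t\<bar> powr (2 * \<mu>)))"
    by (simp add: complex_norm_square[symmetric])
  also have "\<dots> = of_real (LINT t|lebesgue. (cmod (f t))\<^sup>2 * \<bar>t\<bar> powr (2 * \<mu>))"
    by (rule integral_complex_of_real)
  finally show "(LINT t|lebesgue. f t * cnj (f t) * of_real (\<bar>t\<bar> powr (2 * \<mu>)))
      = of_real ((sqrt (LINT t|lebesgue. (cmod (f t))\<^sup>2 * \<bar>t\<bar> powr (2 * \<mu>)))\<^sup>2)"
    by (simp add: integral_nonneg_AE)
qed

lemma L2_inner_scale_right: "L2_inner \<mu> Y (scale_aefun c X) = cnj c * L2_inner \<mu> Y X"
  by (simp add: L2_inner_cnj[of \<mu> Y] L2_inner_scale_left)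

lemma L2_scale: "X \<in> L2 \<mu> \<Longrightarrow> scale_aefun c X \<in> L2 \<mu>"
  and L2_add: "X \<in> L2 \<mu> \<Longrightarrow> Y \<in> L2 \<mu> \<Longrightarrow> X + Y \<in> L2 \<mu>"
  and L2_diff: "X \<in> L2 \<mu> \<Longrightarrow> Y \<in> L2 \<mu> \<Longrightarrow> X - Y \<in> L2 \<mu>"
  and L2_sum: "(\<And>i. i \<in> A \<Longrightarrow> F i \<in> L2 \<mu>) \<Longrightarrow> sum F A \<in> L2 \<mu>"
  by (auto intro: aefun.subspace_scale[OF L2_subspace] aefun.subspace_add[OF L2_subspace]
      aefun.subspace_diff[OF L2_subspace] aefun.subspace_sum[OF L2_subspace])

lemma L2_inner_zero_left [simp]: "L2_inner \<mu> 0 Y = 0"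
  using L2_inner_scale_left[of \<mu> 0 0 Y] by simp

lemma L2_inner_diff_left:
  assumes "X \<in> L2 \<mu>" "Y \<in> L2 \<mu>" "Z \<in> L2 \<mu>"
  shows "L2_inner \<mu> (X - Y) Z = L2_inner \<mu> X Z - L2_inner \<mu> Y Z"
  using L2_inner_add_left[OF L2_diff[OF assms(1,2)] assms(2,3)] by simp

lemma L2_inner_diff_right:
  assumes "X \<in> L2 \<mu>" "Y \<in> L2 \<mu>" "Z \<in> L2 \<mu>"
  shows "L2_inner \<mu> Z (X - Y) = L2_inner \<mu> Z X - L2_inner \<mu> Z Y"
  using L2_inner_diff_left[OF assms] by (simp add: L2_inner_cnj[of \<mu> Z])

lemma L2_inner_sum_left:
  assumes "\<And>i. i \<in> A \<Longrightarrow> F i \<in> L2 \<mu>" "Y \<in> L2 \<mu>"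
  shows "L2_inner \<mu> (sum F A) Y = (\<Sum>i\<in>A. L2_inner \<mu> (F i) Y)"
  using assms
  by (induction A rule: infinite_finite_induct) (simp_all add: L2_inner_add_left L2_sum)

lemma L2_Cauchy_Schwarz:
  assumes X: "X \<in> L2 \<mu>" and Y: "Y \<in> L2 \<mu>"
  shows "cmod (L2_inner \<mu> X Y) \<le> L2_norm \<mu> X * L2_norm \<mu> Y"
proof (cases "Y = 0")
  case True
  then show ?thesis
    using L2_inner_cnj[of \<mu> Y X] by (simp add: L2_norm_nonneg)
next
  case False
  define N where "N = (L2_norm \<mu> Y)\<^sup>2"
  define p where "p = L2_inner \<mu> X Y"
  have "L2_norm \<mu> Y \<noteq> 0"
    using False L2_norm_eq_0_iff[OF Y] by simp
  then have N: "N > 0"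
    by (simp add: N_def)
  \<comment> \<open>With this coefficient, \<open>c Y\<close> is the orthogonal projection of \<open>X\<close> onto the line of \<open>Y\<close>.\<close>
  define c where "c = p / of_real N"
  let ?Z = "X - scale_aefun c Y"
  have "of_real ((L2_norm \<mu> ?Z)\<^sup>2) = L2_inner \<mu> ?Z ?Z"
    by (simp only: L2_inner_self)
  also have "\<dots> = L2_inner \<mu> X X - cnj c * p - c * cnj p + c * cnj c * of_real N"
    using X Y by (simp add: L2_inner_diff_left L2_inner_diff_right L2_diff L2_scale L2_inner_scale_left
        L2_inner_scale_right L2_inner_cnj[of \<mu> Y X] L2_inner_self[of \<mu> Y] N_def p_def algebra_simps)
  also have "\<dots> = of_real ((L2_norm \<mu> X)\<^sup>2 - (cmod p)\<^sup>2 / N)"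
  proof -
    have "(complex_of_real (cmod p))\<^sup>2 = p * cnj p"
      by (simp only: complex_norm_square flip: of_real_power)
    then show ?thesis
      using N by (simp add: c_def L2_inner_self field_simps)
  qed
  finally have "(L2_norm \<mu> ?Z)\<^sup>2 = (L2_norm \<mu> X)\<^sup>2 - (cmod p)\<^sup>2 / N"
    by (simp only: of_real_eq_iff)
  then have "(cmod p)\<^sup>2 / N \<le> (L2_norm \<mu> X)\<^sup>2"
    using zero_le_power2[of "L2_norm \<mu> ?Z"] by linarith
  then have "(cmod p)\<^sup>2 \<le> (L2_norm \<mu> X * L2_norm \<mu> Y)\<^sup>2"
    using N by (simp add: N_def field_simps)
  then show ?thesis
    unfolding p_def by (rule power2_le_imp_le) (simp add: L2_norm_nonneg)
qed

lemma L2_norm_square_abs: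
  assumes "f \<in> L2_fun \<mu>"
  shows "ennreal ((L2_norm \<mu> (abs_aefun f))\<^sup>2) = (\<integral>\<^sup>+t. ennreal ((cmod (f t))\<^sup>2 * \<bar>t\<bar> powr (2 * \<mu>)) \<partial>lebesgue)"
  using assms by (subst nn_integral_eq_integral) (auto simp: L2_norm.abs_eq L2_fun_def integral_nonneg_AE)

lemma L2_fun_diff: "f \<in> L2_fun \<mu> \<Longrightarrow> g \<in> L2_fun \<mu> \<Longrightarrow> (\<lambda>t. f t - g t) \<in> L2_fun \<mu>"
  using L2_fun_add[of f \<mu> "\<lambda>t. (-1) * g t"] L2_fun_scale[of g \<mu> "-1"] by simp

lemma gauss_in_L2_fun:
  assumes "\<mu> > - 1/2"
  shows "(\<lambda>t. complex_of_real (exp (- (t\<^sup>2) / 2))) \<in> L2_fun \<mu>"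
proof -
  have "(\<lambda>t. complex_of_real (exp (- (t\<^sup>2) / 2))) \<in> borel_measurable lebesgue"
    by (rule measurable_completion) measurable
  moreover have "(cmod (of_real (exp (- (t\<^sup>2) / 2))))\<^sup>2 * \<bar>t\<bar> powr (2 * \<mu>) = exp (0 * \<bar>t\<bar>) * gauss_weight \<mu> 1 t" for t
    by (simp add: gauss_weight_def power2_eq_square flip: exp_add)
  ultimately show ?thesis
    unfolding L2_fun_def using integrable_exp_gauss_weight[OF assms, of 1 0] by auto
qed

text \<open>
  Multiplication by the square integrable function \<open>exp (-t\<^sup>2/2)\<close> turns a Cauchy sequence in
  \<open>L\<^sup>2\<^sub>\<mu>\<close> into one in \<open>L\<^sup>1\<close> for the same weight, which has a subsequence converging almost everywhere.
\<close>

lemma L2_complete: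
  assumes \<mu>: "\<mu> > - 1/2" and X: "\<And>n. X n \<in> L2 \<mu>"
    and Cauchy: "\<And>e. e > 0 \<Longrightarrow> \<exists>N. \<forall>i\<ge>N. \<forall>j\<ge>N. L2_norm \<mu> (X i - X j) < e"
  obtains L where "L \<in> L2 \<mu>" "(\<lambda>n. L2_norm \<mu> (X n - L)) \<longlonglongrightarrow> 0"
proof -
  let ?w = "\<lambda>t::real. \<bar>t\<bar> powr (2 * \<mu>)"
  have "\<forall>n. \<exists>f. f \<in> L2_fun \<mu> \<and> X n = abs_aefun f"
    using X by (auto simp: L2_def image_iff)
  then obtain f where f: "\<And>n. f n \<in> L2_fun \<mu>" and Xf: "\<And>n. X n = abs_aefun (f n)"
    by metis
  have [measurable]: "f n \<in> borel_measurable lebesgue" for n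
    using f[of n] by (simp add: L2_fun_def)
  define G where "G = abs_aefun (\<lambda>t. complex_of_real (exp (- (t\<^sup>2) / 2)))"
  have G: "G \<in> L2 \<mu>"
    unfolding G_def abs_aefun_in_L2_iff by (rule gauss_in_L2_fun[OF \<mu>])
  define s where "s n t = f n t * of_real (gauss_weight \<mu> (1/2) t)" for n t
  have s_int: "integrable lebesgue (s n)" for n
    using integrable_exp_times_L2_fun[OF \<mu> f, of 0 n] by (simp add: s_def[abs_def])
  have L1_le: "(LINT t|lebesgue. norm (s i t - s j t)) \<le> L2_norm \<mu> (X i - X j) * L2_norm \<mu> G" for i j
  proof -
    let ?u = "\<lambda>t. complex_of_real (cmod (f i t - f j t))"
    have u: "?u \<in> L2_fun \<mu>"
      using L2_fun_diff[OF f f, of i j] by (simp add: L2_fun_def)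
    have "norm (s i t - s j t) = Re (?u t * cnj (of_real (exp (- (t\<^sup>2) / 2))) * of_real (?w t))" for t
    proof -
      have "s i t - s j t = (f i t - f j t) * of_real (gauss_weight \<mu> (1/2) t)"
        by (simp add: s_def algebra_simps)
      then show ?thesis
        by (simp add: norm_mult gauss_weight_nonneg) (simp add: gauss_weight_def)
    qed
    then have "(LINT t|lebesgue. norm (s i t - s j t))
        = Re (LINT t|lebesgue. ?u t * cnj (of_real (exp (- (t\<^sup>2) / 2))) * of_real (?w t))"
      by (simp only: integral_Re[OF L2_inner_integrable[OF u gauss_in_L2_fun[OF \<mu>]]])
    also have "\<dots> = Re (L2_inner \<mu> (abs_aefun ?u) G)"
      by (simp add: G_def L2_inner.abs_eq)
    also have "\<dots> \<le> cmod (L2_inner \<mu> (abs_aefun ?u) G)"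
      by (rule complex_Re_le_cmod)
    also have "\<dots> \<le> L2_norm \<mu> (abs_aefun ?u) * L2_norm \<mu> G"
      using u G by (intro L2_Cauchy_Schwarz) (simp_all add: abs_aefun_in_L2_iff)
    also have "L2_norm \<mu> (abs_aefun ?u) = L2_norm \<mu> (X i - X j)"
      by (simp add: Xf minus_aefun.abs_eq L2_norm.abs_eq)
    finally show ?thesis .
  qed
  obtain r where r: "strict_mono r" and ae_s: "AE t in lebesgue. Cauchy (\<lambda>i. s (r i) t)"
  proof (rule cauchy_L1_AE_cauchy_subseq[OF s_int])
    fix e :: real assume e: "e > 0"
    then have "e / (L2_norm \<mu> G + 1) > 0"
      by (intro divide_pos_pos) (auto simp: add_nonneg_pos L2_norm_nonneg)
    then obtain N where N: "\<And>i j. i \<ge> N \<Longrightarrow> j \<ge> N \<Longrightarrow> L2_norm \<mu> (X i - X j) < e / (L2_norm \<mu> G + 1)"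
      using Cauchy by meson
    have "(LINT t|lebesgue. norm (s i t - s j t)) < e" if "i \<ge> N" "j \<ge> N" for i j
    proof -
      have "(LINT t|lebesgue. norm (s i t - s j t)) \<le> L2_norm \<mu> (X i - X j) * (L2_norm \<mu> G + 1)"
        using L1_le[of i j] L2_norm_nonneg[of \<mu> "X i - X j"] by (simp add: algebra_simps)
      also have "\<dots> < e"
        using N[OF that] L2_norm_nonneg[of \<mu> G] by (simp add: pos_less_divide_eq)
      finally show ?thesis .
    qed
    then show "\<exists>N. \<forall>i\<ge>N. \<forall>j\<ge>N. (LINT t|lebesgue. norm (s i t - s j t)) < e"
      by blast
  qed
  define F where "F t = lim (\<lambda>i. f (r i) t)" for t
  have [measurable]: "F \<in> borel_measurable lebesgue"
    unfolding F_def[abs_def] by measurable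
  have "AE t in lebesgue. t \<noteq> (0::real)"
    by (rule AE_completion) (rule AE_lborel_singleton)
  with ae_s have ae_F: "AE t in lebesgue. (\<lambda>i. f (r i) t) \<longlonglongrightarrow> F t"
  proof eventually_elim
    case (elim t)
    then have g: "gauss_weight \<mu> (1/2) t \<noteq> 0"
      by (simp add: gauss_weight_def)
    from elim obtain l where "(\<lambda>i. s (r i) t) \<longlonglongrightarrow> l"
      by (auto simp: Cauchy_convergent_iff convergent_def)
    then have "(\<lambda>i. s (r i) t / of_real (gauss_weight \<mu> (1/2) t)) \<longlonglongrightarrow> l / of_real (gauss_weight \<mu> (1/2) t)"
      using g by (intro tendsto_intros) auto
    then have "convergent (\<lambda>i. f (r i) t)"
      using g by (auto simp: s_def convergent_def)
    then show ?case
      unfolding F_def by (simp add: convergent_LIMSEQ_iff)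
  qed
  \<comment> \<open>Fatou along the subsequence bounds the distance from the limit function to \<open>f n\<close>.\<close>
  have close: "(\<integral>\<^sup>+t. ennreal ((cmod (F t - f n t))\<^sup>2 * ?w t) \<partial>lebesgue) \<le> ennreal (e\<^sup>2)"
    if e: "e > 0" and N: "\<And>i. i \<ge> N \<Longrightarrow> L2_norm \<mu> (X i - X n) < e" for n N e
  proof -
    have "(\<integral>\<^sup>+t. ennreal ((cmod (F t - f n t))\<^sup>2 * ?w t) \<partial>lebesgue)
        = (\<integral>\<^sup>+t. liminf (\<lambda>i. ennreal ((cmod (f (r i) t - f n t))\<^sup>2 * ?w t)) \<partial>lebesgue)"
    proof (rule nn_integral_cong_AE, use ae_F in eventually_elim)
      fix t assume "(\<lambda>i. f (r i) t) \<longlonglongrightarrow> F t"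
      then have "(\<lambda>i. ennreal ((cmod (f (r i) t - f n t))\<^sup>2 * ?w t)) \<longlonglongrightarrow> ennreal ((cmod (F t - f n t))\<^sup>2 * ?w t)"
        by (intro tendsto_intros)
      then show "ennreal ((cmod (F t - f n t))\<^sup>2 * ?w t) = liminf (\<lambda>i. ennreal ((cmod (f (r i) t - f n t))\<^sup>2 * ?w t))"
        by (rule lim_imp_Liminf[symmetric, OF sequentially_bot])
    qed
    also have "\<dots> \<le> liminf (\<lambda>i. \<integral>\<^sup>+t. ennreal ((cmod (f (r i) t - f n t))\<^sup>2 * ?w t) \<partial>lebesgue)"
      by (rule nn_integral_liminf) measurable
    also have "\<dots> = liminf (\<lambda>i. ennreal ((L2_norm \<mu> (X (r i) - X n))\<^sup>2))"
      using L2_norm_square_abs[OF L2_fun_diff[OF f f]] by (simp add: Xf minus_aefun.abs_eq)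
    also have "\<dots> \<le> ennreal (e\<^sup>2)"
    proof (rule Liminf_le)
      have "L2_norm \<mu> (X (r i) - X n) \<le> e" if "i \<ge> N" for i
        using N[of "r i"] seq_suble[OF r, of i] that by force
      then show "\<forall>\<^sub>F i in sequentially. ennreal ((L2_norm \<mu> (X (r i) - X n))\<^sup>2) \<le> ennreal (e\<^sup>2)"
        unfolding eventually_sequentially
        by (auto intro!: exI[of _ N] ennreal_leI power_mono L2_norm_nonneg)
    qed simp
    finally show ?thesis .
  qed
  have F: "F \<in> L2_fun \<mu>"
  proof -
    obtain N where N: "\<And>i. i \<ge> N \<Longrightarrow> L2_norm \<mu> (X i - X N) < 1"
      using Cauchy[of 1] by auto
    have "(\<integral>\<^sup>+t. ennreal ((cmod (F t - f N t))\<^sup>2 * ?w t) \<partial>lebesgue) \<le> ennreal (1\<^sup>2)"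
      by (rule close[of 1 N N]) (use N in auto)
    then have fin: "(\<integral>\<^sup>+t. ennreal ((cmod (F t - f N t))\<^sup>2 * ?w t) \<partial>lebesgue) < \<infinity>"
      by (rule le_less_trans) simp
    have "(\<lambda>t. F t - f N t) \<in> L2_fun \<mu>"
      unfolding L2_fun_def using fin by (auto intro!: integrableI_bounded)
    from L2_fun_add[OF this f[of N]] show ?thesis by simp
  qed
  have "(\<lambda>n. L2_norm \<mu> (X n - abs_aefun F)) \<longlonglongrightarrow> 0"
  proof (rule LIMSEQ_I)
    fix e :: real assume e: "e > 0"
    then obtain N where N: "\<And>i j. i \<ge> N \<Longrightarrow> j \<ge> N \<Longrightarrow> L2_norm \<mu> (X i - X j) < e / 2"
      using Cauchy[of "e / 2"] by auto
    have "norm (L2_norm \<mu> (X n - abs_aefun F) - 0) < e" if n: "n \<ge> N" for n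
    proof -
      have "ennreal ((L2_norm \<mu> (abs_aefun F - X n))\<^sup>2) \<le> ennreal ((e / 2)\<^sup>2)"
        using close[of "e / 2" N n] N n e L2_norm_square_abs[OF L2_fun_diff[OF F f[of n]]]
        by (simp add: Xf minus_aefun.abs_eq)
      then have "(L2_norm \<mu> (abs_aefun F - X n))\<^sup>2 \<le> (e / 2)\<^sup>2"
        by (simp only: ennreal_le_iff zero_le_power2)
      then have "L2_norm \<mu> (abs_aefun F - X n) \<le> e / 2"
        by (rule power2_le_imp_le) (use e in simp)
      moreover have "L2_norm \<mu> (abs_aefun F - X n) = L2_norm \<mu> (X n - abs_aefun F)"
        using Metric_space.commute[OF L2_Metric_space] .
      ultimately show ?thesis
        using e L2_norm_nonneg[of \<mu> "X n - abs_aefun F"] by simp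
    qed
    then show "\<exists>N. \<forall>n\<ge>N. norm (L2_norm \<mu> (X n - abs_aefun F) - 0) < e" by blast
  qed
  with F show ?thesis
    by (intro that) (simp_all add: abs_aefun_in_L2_iff)
qed

section \<open>Orthonormal bases and diagonal operators\<close>

text \<open>
  Totality is stated as: only zero is orthogonal to all the basis vectors. Together with
  completeness of the space it implies that the linear span is dense.
\<close>

locale L2_basis =
  fixes \<mu> :: real and e :: "nat \<Rightarrow> aefun"
  assumes \<mu>: "\<mu> > - 1/2"
    and orthonormal: "L2_orthonormal \<mu> e"
    and total: "\<And>X. X \<in> L2 \<mu> \<Longrightarrow> (\<And>n. L2_inner \<mu> X (e n) = 0) \<Longrightarrow> X = 0"
begin

abbreviation coeff :: "aefun \<Rightarrow> nat \<Rightarrow> complex" where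
  "coeff X n \<equiv> L2_inner \<mu> X (e n)"

text \<open>
  The linear combination of the basis vectors with index in \<open>A\<close>.
\<close>

definition comb :: "(nat \<Rightarrow> complex) \<Rightarrow> nat set \<Rightarrow> aefun" where
  "comb a A = (\<Sum>n\<in>A. scale_aefun (a n) (e n))"

lemma basis_in_L2: "e n \<in> L2 \<mu>"
  using orthonormal by (auto simp: L2_orthonormal_def)

lemma coeff_basis: "coeff (e m) n = (if m = n then 1 else 0)"
  using orthonormal by (simp add: L2_orthonormal_def)

lemma comb_in_L2: "comb a A \<in> L2 \<mu>"
  unfolding comb_def by (intro L2_sum L2_scale basis_in_L2)

lemma inner_comb:
  assumes "Y \<in> L2 \<mu>"
  shows "L2_inner \<mu> (comb a A) Y = (\<Sum>n\<in>A. a n * cnj (coeff Y n))"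
  unfolding comb_def using assms
  by (simp add: L2_inner_sum_left L2_scale basis_in_L2 L2_inner_scale_left L2_inner_cnj[of \<mu> "e _" Y])

lemma coeff_comb:
  assumes "finite A"
  shows "coeff (comb a A) n = (if n \<in> A then a n else 0)"
  using assms by (simp add: inner_comb basis_in_L2 coeff_basis if_distrib sum.delta cong: if_cong)

lemma norm_comb_square:
  assumes "finite A"
  shows "(L2_norm \<mu> (comb a A))\<^sup>2 = (\<Sum>n\<in>A. (cmod (a n))\<^sup>2)"
proof -
  have "complex_of_real ((L2_norm \<mu> (comb a A))\<^sup>2) = (\<Sum>n\<in>A. a n * cnj (a n))"
    using assms by (simp only: L2_inner_self[symmetric] inner_comb[OF comb_in_L2] coeff_comb) simp
  also have "\<dots> = of_real (\<Sum>n\<in>A. (cmod (a n))\<^sup>2)"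
    by (simp only: of_real_sum complex_norm_square)
  finally show ?thesis by (simp only: of_real_eq_iff)
qed

lemma comb_diff:
  assumes "finite A" "B \<subseteq> A"
  shows "comb a A - comb a B = comb a (A - B)"
  using sum.subset_diff[OF assms(2,1), of "\<lambda>n. scale_aefun (a n) (e n)"] by (simp add: comb_def)

lemma Bessel:
  assumes X: "X \<in> L2 \<mu>"
  shows "(\<Sum>n<N. (cmod (coeff X n))\<^sup>2) \<le> (L2_norm \<mu> X)\<^sup>2"
proof -
  let ?P = "comb (coeff X) {..<N}"
  let ?S = "\<Sum>n<N. (cmod (coeff X n))\<^sup>2"
  have P: "L2_inner \<mu> ?P X = of_real ?S"
    using X by (simp only: inner_comb of_real_sum complex_norm_square)
  have "of_real ((L2_norm \<mu> (X - ?P))\<^sup>2) = L2_inner \<mu> (X - ?P) (X - ?P)"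
    by (simp only: L2_inner_self)
  also have "\<dots> = of_real ((L2_norm \<mu> X)\<^sup>2 - ?S)"
    using X comb_in_L2
    by (simp add: L2_inner_diff_left L2_inner_diff_right L2_diff L2_inner_cnj[of \<mu> X ?P] P)
      (simp add: L2_inner_self norm_comb_square flip: of_real_power)
  finally have "(L2_norm \<mu> (X - ?P))\<^sup>2 = (L2_norm \<mu> X)\<^sup>2 - ?S"
    by (simp only: of_real_eq_iff)
  then show ?thesis
    using zero_le_power2[of "L2_norm \<mu> (X - ?P)"] by linarith
qed

lemma summable_coeff_square:
  assumes "X \<in> L2 \<mu>"
  shows "summable (\<lambda>n. (cmod (coeff X n))\<^sup>2)"
  by (rule summableI_nonneg_bounded[OF _ Bessel[OF assms]]) simp

lemma inner_tendsto:
  assumes F: "\<And>n. F n \<in> L2 \<mu>" and L: "L \<in> L2 \<mu>" and Y: "Y \<in> L2 \<mu>"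
    and lim: "(\<lambda>n. L2_norm \<mu> (F n - L)) \<longlonglongrightarrow> 0"
  shows "(\<lambda>n. L2_inner \<mu> (F n) Y) \<longlonglongrightarrow> L2_inner \<mu> L Y"
proof (rule LIM_zero_cancel, rule Lim_null_comparison)
  show "\<forall>\<^sub>F n in sequentially. norm (L2_inner \<mu> (F n) Y - L2_inner \<mu> L Y) \<le> L2_norm \<mu> (F n - L) * L2_norm \<mu> Y"
    using L2_Cauchy_Schwarz[OF L2_diff[OF F L] Y] F L Y by (simp add: L2_inner_diff_left)
  show "(\<lambda>n. L2_norm \<mu> (F n - L) * L2_norm \<mu> Y) \<longlonglongrightarrow> 0"
    using tendsto_mult_right[OF lim, of "L2_norm \<mu> Y"] by simp
qed

lemma Riesz_Fischer:
  assumes a: "summable (\<lambda>n. (cmod (a n))\<^sup>2)"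
  obtains X where "X \<in> L2 \<mu>" "\<And>n. coeff X n = a n" "(\<lambda>N. L2_norm \<mu> (comb a {..<N} - X)) \<longlonglongrightarrow> 0"
proof -
  have sq: "(L2_norm \<mu> (comb a {..<n} - comb a {..<m}))\<^sup>2 = (\<Sum>k=m..<n. (cmod (a k))\<^sup>2)" if "m \<le> n" for m n
    using that by (simp add: comb_diff norm_comb_square lessThan_minus_lessThan)
  have cau: "\<exists>N. \<forall>i\<ge>N. \<forall>j\<ge>N. L2_norm \<mu> (comb a {..<i} - comb a {..<j}) < \<epsilon>" if "\<epsilon> > 0" for \<epsilon>
  proof -
    from that have "\<epsilon>\<^sup>2 > 0" by simp
    then obtain N where N: "\<And>m n. m \<ge> N \<Longrightarrow> norm (\<Sum>k=m..<n. (cmod (a k))\<^sup>2) < \<epsilon>\<^sup>2"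
      using a unfolding summable_Cauchy by meson
    have le: "L2_norm \<mu> (comb a {..<n} - comb a {..<m}) < \<epsilon>" if "m \<ge> N" "m \<le> n" for m n
    proof -
      have "(L2_norm \<mu> (comb a {..<n} - comb a {..<m}))\<^sup>2 < \<epsilon>\<^sup>2"
        using N[OF that(1), of n] by (simp add: sq[OF that(2)])
      then show ?thesis
        by (rule power_less_imp_less_base) (use \<open>\<epsilon> > 0\<close> in simp)
    qed
    have "L2_norm \<mu> (comb a {..<i} - comb a {..<j}) < \<epsilon>" if "i \<ge> N" "j \<ge> N" for i j
      using le[of i j] le[of j i] that Metric_space.commute[OF L2_Metric_space, of \<mu> "comb a {..<i}" "comb a {..<j}"]
      by (cases "i \<le> j") auto
    then show ?thesis by blast
  qed
  obtain X where X: "X \<in> L2 \<mu>" and lim: "(\<lambda>N. L2_norm \<mu> (comb a {..<N} - X)) \<longlonglongrightarrow> 0"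
    by (rule L2_complete[OF \<mu> comb_in_L2 cau])
  have "coeff X n = a n" for n
  proof (rule LIMSEQ_unique)
    show "(\<lambda>N. coeff (comb a {..<N}) n) \<longlonglongrightarrow> coeff X n"
      by (rule inner_tendsto[OF comb_in_L2 X basis_in_L2 lim])
    show "(\<lambda>N. coeff (comb a {..<N}) n) \<longlonglongrightarrow> a n"
      by (rule tendsto_eventually, rule eventually_mono[OF eventually_gt_at_top[of n]]) (simp add: coeff_comb)
  qed
  with X lim show ?thesis by (intro that)
qed

lemma eq_if_coeff_eq:
  assumes "X \<in> L2 \<mu>" "Y \<in> L2 \<mu>" "\<And>n. coeff X n = coeff Y n"
  shows "X = Y"
  using total[of "X - Y"] assms by (simp add: L2_diff L2_inner_diff_left basis_in_L2)

lemma basis_expansion: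
  assumes X: "X \<in> L2 \<mu>"
  shows "(\<lambda>N. L2_norm \<mu> (comb (coeff X) {..<N} - X)) \<longlonglongrightarrow> 0"
proof -
  obtain Y where "Y \<in> L2 \<mu>" "\<And>n. coeff Y n = coeff X n" "(\<lambda>N. L2_norm \<mu> (comb (coeff X) {..<N} - Y)) \<longlonglongrightarrow> 0"
    using Riesz_Fischer[OF summable_coeff_square[OF X]] by blast
  with eq_if_coeff_eq[OF X] show ?thesis by metis
qed

lemma Parseval:
  assumes "X \<in> L2 \<mu>" "Y \<in> L2 \<mu>"
  shows "(\<lambda>n. coeff X n * cnj (coeff Y n)) sums L2_inner \<mu> X Y"
  using inner_tendsto[OF comb_in_L2 assms basis_expansion[OF assms(1)]] assms(2)
  by (simp add: sums_def inner_comb)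

lemma limitin_basis_expansion:
  assumes "X \<in> L2 \<mu>"
  shows "limitin (L2_topology \<mu>) (\<lambda>N. comb (coeff X) {..<N}) X sequentially"
  unfolding L2_topology_def Metric_space.limitin_metric_dist_null[OF L2_Metric_space]
  using assms basis_expansion[OF assms] comb_in_L2 by simp

lemma complete_orthonormal: "L2_complete_orthonormal \<mu> e"
proof -
  have comb_span: "comb a A \<in> aefun.span (range e)" for a A
    unfolding comb_def by (intro aefun.span_sum aefun.span_scale aefun.span_base) auto
  have "X \<in> L2_topology \<mu> closure_of aefun.span (range e)" if X: "X \<in> L2 \<mu>" for X
    unfolding L2_topology_def Metric_space.metric_closure_of[OF L2_Metric_space] mem_Collect_eq
  proof (intro conjI allI impI X)
    fix r :: real assume "r > 0"
    then obtain N where N: "norm (L2_norm \<mu> (comb (coeff X) {..<N} - X) - 0) < r"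
      using LIMSEQ_D[OF basis_expansion[OF X]] by blast
    then have "L2_norm \<mu> (X - comb (coeff X) {..<N}) < r"
      by (simp add: Metric_space.commute[OF L2_Metric_space, of \<mu> X])
    then show "\<exists>Y\<in>aefun.span (range e). Y \<in> Metric_space.mball (L2 \<mu>) (\<lambda>X Y. L2_norm \<mu> (X - Y)) X r"
      using X comb_in_L2 comb_span by (intro bexI[of _ "comb (coeff X) {..<N}"]) (auto simp: Metric_space.in_mball[OF L2_Metric_space])
  qed
  moreover have "L2_topology \<mu> closure_of aefun.span (range e) \<subseteq> L2 \<mu>"
    using closure_of_subset_topspace[of "L2_topology \<mu>"]
    by (simp add: L2_topology_def Metric_space.topspace_mtopology[OF L2_Metric_space])
  ultimately show ?thesis
    using orthonormal by (auto simp: L2_complete_orthonormal_def)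
qed

text \<open>
  The operator that multiplies the \<open>n\<close>-th coordinate by \<open>d n\<close>. It is meaningful on \<open>L2 \<mu>\<close> for bounded
  \<open>d\<close>; all uses have \<open>\<bar>d n\<bar> = 1\<close>.
\<close>

definition diag :: "(nat \<Rightarrow> complex) \<Rightarrow> aefun \<Rightarrow> aefun" where
  "diag d X = (SOME Z. Z \<in> L2 \<mu> \<and> (\<forall>n. coeff Z n = d n * coeff X n))"

context
  fixes d :: "nat \<Rightarrow> complex"
  assumes norm_d: "\<And>n. cmod (d n) = 1"
begin

lemma diag_in_L2: "X \<in> L2 \<mu> \<Longrightarrow> diag d X \<in> L2 \<mu>"
  and coeff_diag: "X \<in> L2 \<mu> \<Longrightarrow> coeff (diag d X) n = d n * coeff X n"
proof -
  assume X: "X \<in> L2 \<mu>"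
  have "summable (\<lambda>n. (cmod (d n * coeff X n))\<^sup>2)"
    using summable_coeff_square[OF X] by (simp add: norm_mult norm_d)
  then have "\<exists>Z. Z \<in> L2 \<mu> \<and> (\<forall>n. coeff Z n = d n * coeff X n)"
    using Riesz_Fischer[of "\<lambda>n. d n * coeff X n"] by blast
  then have "diag d X \<in> L2 \<mu> \<and> (\<forall>n. coeff (diag d X) n = d n * coeff X n)"
    unfolding diag_def by (rule someI_ex)
  then show "diag d X \<in> L2 \<mu>" "coeff (diag d X) n = d n * coeff X n" by auto
qed

lemma diag_eqI:
  assumes "X \<in> L2 \<mu>" "Z \<in> L2 \<mu>" "\<And>n. coeff Z n = d n * coeff X n"
  shows "diag d X = Z"
  using assms by (intro eq_if_coeff_eq) (simp_all add: diag_in_L2 coeff_diag)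

lemma diag_comb: "finite A \<Longrightarrow> diag d (comb a A) = comb (\<lambda>n. d n * a n) A"
  by (rule diag_eqI) (simp_all add: comb_in_L2 coeff_comb)

lemma diag_basis: "diag d (e n) = scale_aefun (d n) (e n)"
  by (rule diag_eqI) (auto simp: basis_in_L2 L2_scale L2_inner_scale_left coeff_basis)

lemma diag_linear: "L2_linear \<mu> (diag d)"
  unfolding L2_linear_def
  by (auto intro!: diag_eqI simp: diag_in_L2 coeff_diag L2_add L2_scale L2_inner_add_left
      L2_inner_scale_left basis_in_L2 algebra_simps)

lemma cnj_mult_unimodular: "cnj (d n) * d n = 1" "d n * cnj (d n) = 1"
  using norm_d[of n] complex_norm_square[of "d n"] by (simp_all add: mult.commute)

lemma diag_inner:
  assumes "X \<in> L2 \<mu>" "Y \<in> L2 \<mu>"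
  shows "L2_inner \<mu> (diag d X) (diag d Y) = L2_inner \<mu> X Y"
proof (rule sums_unique2)
  show "(\<lambda>n. coeff (diag d X) n * cnj (coeff (diag d Y) n)) sums L2_inner \<mu> (diag d X) (diag d Y)"
    using assms by (intro Parseval diag_in_L2)
  have "coeff (diag d X) n * cnj (coeff (diag d Y) n) = coeff X n * cnj (coeff Y n)" for n
    using assms cnj_mult_unimodular(1)[of n] by (simp add: coeff_diag mult_ac)
  then show "(\<lambda>n. coeff (diag d X) n * cnj (coeff (diag d Y) n)) sums L2_inner \<mu> X Y"
    using Parseval[OF assms] by simp
qed

lemma diag_norm:
  assumes "X \<in> L2 \<mu>"
  shows "L2_norm \<mu> (diag d X) = L2_norm \<mu> X"
proof -
  have "complex_of_real ((L2_norm \<mu> (diag d X))\<^sup>2) = of_real ((L2_norm \<mu> X)\<^sup>2)"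
    using diag_inner[OF assms assms] by (simp only: L2_inner_self)
  then show ?thesis
    by (simp only: of_real_eq_iff) (simp add: L2_norm_nonneg)
qed

lemma diag_continuous: "continuous_map (L2_topology \<mu>) (L2_topology \<mu>) (diag d)"
  unfolding L2_topology_def
    Metric_space.metric_continuous_map[OF L2_Metric_space L2_Metric_space]
proof (intro conjI ballI allI impI)
  show "diag d ` L2 \<mu> \<subseteq> L2 \<mu>"
    using diag_in_L2 by auto
  fix X and \<epsilon> :: real assume X: "X \<in> L2 \<mu>" and "\<epsilon> > 0"
  have "diag d X - diag d Y = diag d (X - Y)" if "Y \<in> L2 \<mu>" for Y
    using X that
    by (intro diag_eqI[symmetric]) (simp_all add: L2_diff diag_in_L2 coeff_diag L2_inner_diff_left basis_in_L2 algebra_simps)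
  then show "\<exists>\<delta>>0. \<forall>Y. Y \<in> L2 \<mu> \<and> L2_norm \<mu> (X - Y) < \<delta> \<longrightarrow> L2_norm \<mu> (diag d X - diag d Y) < \<epsilon>"
    using X \<open>\<epsilon> > 0\<close> by (intro exI[of _ \<epsilon>]) (simp add: diag_norm L2_diff)
qed

end

context
  fixes d :: "nat \<Rightarrow> complex"
  assumes norm_d: "\<And>n. cmod (d n) = 1"
begin

lemma diag_diag_cnj:
  assumes "X \<in> L2 \<mu>"
  shows "diag d (diag (\<lambda>n. cnj (d n)) X) = X" "diag (\<lambda>n. cnj (d n)) (diag d X) = X"
  using assms cnj_mult_unimodular[of d, OF norm_d]
  by (auto intro!: diag_eqI simp: norm_d diag_in_L2 coeff_diag simp flip: mult.assoc)

lemma diag_inner_cnj: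
  assumes "X \<in> L2 \<mu>" "Y \<in> L2 \<mu>"
  shows "L2_inner \<mu> (diag d X) Y = L2_inner \<mu> X (diag (\<lambda>n. cnj (d n)) Y)"
  using diag_inner[of d X "diag (\<lambda>n. cnj (d n)) Y", OF norm_d] assms
  by (simp add: diag_diag_cnj diag_in_L2 norm_d)

context
  fixes T :: "aefun \<Rightarrow> aefun"
  assumes T: "\<And>X. X \<in> L2 \<mu> \<Longrightarrow> T X = diag d X"
begin

lemma L2_adjoint_diag:
  assumes Y: "Y \<in> L2 \<mu>"
  shows "L2_adjoint \<mu> T Y = diag (\<lambda>n. cnj (d n)) Y"
  unfolding L2_adjoint_def
proof (rule the_equality)
  show "diag (\<lambda>n. cnj (d n)) Y \<in> L2 \<mu> \<and>
      (\<forall>X\<in>L2 \<mu>. L2_inner \<mu> (T X) Y = L2_inner \<mu> X (diag (\<lambda>n. cnj (d n)) Y))"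
    using Y by (simp add: T diag_inner_cnj diag_in_L2 norm_d)
  fix Z assume Z: "Z \<in> L2 \<mu> \<and> (\<forall>X\<in>L2 \<mu>. L2_inner \<mu> (T X) Y = L2_inner \<mu> X Z)"
  show "Z = diag (\<lambda>n. cnj (d n)) Y"
  proof (rule eq_if_coeff_eq)
    fix n
    have "L2_inner \<mu> (e n) Z = L2_inner \<mu> (T (e n)) Y"
      using Z basis_in_L2[of n] by simp
    also have "\<dots> = L2_inner \<mu> (e n) (diag (\<lambda>n. cnj (d n)) Y)"
      using Y basis_in_L2[of n] by (simp add: T diag_inner_cnj)
    finally show "coeff Z n = coeff (diag (\<lambda>n. cnj (d n)) Y) n"
      by (simp add: L2_inner_cnj[of \<mu> _ "e n"])
  qed (use Z Y in \<open>auto simp: diag_in_L2 norm_d\<close>)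
qed

lemma L2_unitary_diag: "L2_unitary \<mu> T"
proof -
  have "bij_betw T (L2 \<mu>) (L2 \<mu>)"
    by (rule bij_betw_byWitness[where f' = "diag (\<lambda>n. cnj (d n))"])
      (auto simp: T diag_diag_cnj diag_in_L2 norm_d)
  moreover have "L2_linear \<mu> T"
    using diag_linear[of d, OF norm_d] by (simp add: L2_linear_def T L2_add L2_scale)
  ultimately show ?thesis
    by (simp add: L2_unitary_def T diag_inner norm_d)
qed

lemma L2_eigenvector_basis: "L2_eigenvector \<mu> T (d n) (e n)"
proof -
  have "e n \<noteq> 0"
    using coeff_basis[of n n] by auto
  then show ?thesis
    by (simp add: L2_eigenvector_def basis_in_L2 T diag_basis norm_d)
qed

lemma L2_eigenvalues_diag: "L2_eigenvalues \<mu> T = range d"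
proof
  show "range d \<subseteq> L2_eigenvalues \<mu> T"
    using L2_eigenvector_basis by (auto simp: L2_eigenvalues_def)
  show "L2_eigenvalues \<mu> T \<subseteq> range d"
  proof
    fix c assume "c \<in> L2_eigenvalues \<mu> T"
    then obtain X where X: "X \<in> L2 \<mu>" "X \<noteq> 0" "T X = scale_aefun c X"
      by (auto simp: L2_eigenvalues_def L2_eigenvector_def)
    then obtain n where n: "coeff X n \<noteq> 0"
      using total by blast
    have "c * coeff X n = coeff (T X) n"
      by (simp add: X(3) L2_inner_scale_left)
    also have "\<dots> = d n * coeff X n"
      by (simp only: T[OF X(1)] coeff_diag[of d X n, OF norm_d X(1)])
    finally have "c = d n"
      using n by simp
    then show "c \<in> range d" by auto
  qed
qed

end

end

end

section \<open>The generalized Fourier transform\<close>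

lemma hermite_basis:
  assumes \<mu>: "\<mu> > - 1/2"
  shows "L2_basis \<mu> (\<lambda>n. abs_aefun (hermite_fun \<mu> n))"
proof
  show "L2_orthonormal \<mu> (\<lambda>n. abs_aefun (hermite_fun \<mu> n))"
    unfolding L2_orthonormal_def
  proof (intro conjI allI)
    show "range (\<lambda>n. abs_aefun (hermite_fun \<mu> n)) \<subseteq> L2 \<mu>"
      using hermite_fun_in_L2_fun[OF \<mu>] by (auto simp: abs_aefun_in_L2_iff)
    show "L2_inner \<mu> (abs_aefun (hermite_fun \<mu> m)) (abs_aefun (hermite_fun \<mu> n)) = (if m = n then 1 else 0)" for m n
      unfolding L2_inner.abs_eq by (rule has_bochner_integral_integral_eq[OF has_bochner_integral_hermite_fun[OF \<mu>]])
  qed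
  fix X assume "X \<in> L2 \<mu>" and orth: "\<And>n. L2_inner \<mu> X (abs_aefun (hermite_fun \<mu> n)) = 0"
  then obtain f where X: "X = abs_aefun f" and f: "f \<in> L2_fun \<mu>"
    by (auto simp: L2_def)
  have "AE t in lebesgue. f t = 0"
    by (rule hermite_fun_total[OF \<mu> f]) (use orth in \<open>simp only: X L2_inner.abs_eq\<close>)
  then show "X = 0"
    by (simp add: X zero_aefun.abs_eq abs_aefun_eq_iff)
qed (fact \<mu>)

lemma abs_aefun_sum_scale:
  assumes "finite A"
  shows "abs_aefun (\<lambda>t. \<Sum>n\<in>A. c n * f n t) = (\<Sum>n\<in>A. scale_aefun (c n) (abs_aefun (f n)))"
  using assms
  by (induction A) (simp_all add: zero_aefun.abs_eq scale_aefun.abs_eq flip: plus_aefun.abs_eq)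

lemma gft_hermite_span:
  assumes \<mu>: "\<mu> > - 1/2" and \<sigma>: "\<sigma>\<^sup>2 = - 1"
  shows "integrable lebesgue (gft_integrand \<mu> \<sigma> (\<lambda>x. \<Sum>n<N. c n * hermite_fun \<mu> n x) x)"
    and "gft_integral \<mu> \<sigma> (\<lambda>x. \<Sum>n<N. c n * hermite_fun \<mu> n x) x = (\<Sum>n<N. \<sigma> ^ n * c n * hermite_fun \<mu> n x)"
proof -
  let ?f = "\<lambda>x. \<Sum>n<N. c n * hermite_fun \<mu> n x"
  have eq: "gft_integrand \<mu> \<sigma> ?f x = (\<lambda>t. \<Sum>n<N. c n * gft_integrand \<mu> \<sigma> (hermite_fun \<mu> n) x t)"
    by (simp add: fun_eq_iff gft_integrand_def sum_distrib_left sum_distrib_right mult_ac)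
  note int = gft_hermite_fun(1)[OF \<mu> \<sigma>]
  show "integrable lebesgue (gft_integrand \<mu> \<sigma> ?f x)"
    unfolding eq by (intro Bochner_Integration.integrable_sum integrable_mult_right int)
  have "gft_integral \<mu> \<sigma> ?f x = (\<Sum>n<N. c n * gft_integral \<mu> \<sigma> (hermite_fun \<mu> n) x)"
    unfolding gft_integral_def eq
    by (subst Bochner_Integration.integral_sum)
      (intro integrable_mult_right int, simp add: sum_distrib_left mult_ac)
  then show "gft_integral \<mu> \<sigma> ?f x = (\<Sum>n<N. \<sigma> ^ n * c n * hermite_fun \<mu> n x)"
    by (simp add: gft_hermite_fun(2)[OF \<mu> \<sigma>] mult_ac)
qed

text \<open>
  On the span of the Hermite functions the integral transforms are the diagonal operators with
  eigenvalues \<open>\<sigma>\<^sup>n\<close>.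
\<close>

lemma (in L2_basis) abs_aefun_gft_integral_span:
  assumes e: "e = (\<lambda>n. abs_aefun (hermite_fun \<mu> n))" and \<sigma>: "\<sigma>\<^sup>2 = - 1"
  shows "abs_aefun (gft_integral \<mu> \<sigma> (\<lambda>x. \<Sum>n<N. c n * hermite_fun \<mu> n x))
    = diag (\<lambda>n. \<sigma> ^ n) (abs_aefun (\<lambda>x. \<Sum>n<N. c n * hermite_fun \<mu> n x))"
proof -
  have "(cmod \<sigma>)\<^sup>2 = 1"
    using \<sigma> by (simp flip: norm_power)
  then have "cmod \<sigma> = 1"
    by (simp add: power2_eq_1_iff) (smt (verit) norm_ge_zero)
  then have "cmod (\<sigma> ^ n) = 1" for n
    by (simp add: norm_power)
  then have "diag (\<lambda>n. \<sigma> ^ n) (comb c {..<N}) = comb (\<lambda>n. \<sigma> ^ n * c n) {..<N}"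
    by (intro diag_comb) auto
  moreover have "comb a {..<N} = abs_aefun (\<lambda>x. \<Sum>n<N. a n * hermite_fun \<mu> n x)" for a
    unfolding comb_def by (simp add: e abs_aefun_sum_scale)
  moreover have "gft_integral \<mu> \<sigma> (\<lambda>x. \<Sum>n<N. c n * hermite_fun \<mu> n x)
      = (\<lambda>x. \<Sum>n<N. \<sigma> ^ n * c n * hermite_fun \<mu> n x)"
    by (rule ext) (rule gft_hermite_span(2)[OF \<mu> \<sigma>])
  ultimately show ?thesis
    by simp
qed

theorem mainTheorem3:
  fixes \<mu> :: real
  assumes "\<mu> > - 1/2"
  shows "gft_extension \<mu> (gft \<mu>) \<and>
    L2_unitary \<mu> (gft \<mu>) \<and>
    L2_eigenvalues \<mu> (gft \<mu>) = {1, -1, \<i>, -\<i>} \<and>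
    L2_complete_orthonormal \<mu> (\<lambda>n. abs_aefun (hermite_fun \<mu> n)) \<and>
    (\<forall>n. \<exists>c. L2_eigenvector \<mu> (gft \<mu>) c (abs_aefun (hermite_fun \<mu> n))) \<and>
    (\<forall>X\<in>L2 \<mu>. L2_adjoint \<mu> (gft \<mu>) X \<in> L2 \<mu> \<and>
       (\<forall>Y\<in>L2 \<mu>. L2_inner \<mu> (gft \<mu> Y) X = L2_inner \<mu> Y (L2_adjoint \<mu> (gft \<mu>) X)) \<and>
       gft \<mu> (L2_adjoint \<mu> (gft \<mu>) X) = X \<and>
       L2_adjoint \<mu> (gft \<mu>) (gft \<mu> X) = X) \<and>
    (\<forall>f\<in>hermite_span \<mu>.
       (\<forall>x. integrable lebesgue (gft_integrand \<mu> \<i> f x)) \<and>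
       L2_adjoint \<mu> (gft \<mu>) (abs_aefun f) = abs_aefun (gft_integral \<mu> \<i> f))"
proof -
  define e where "e n = abs_aefun (hermite_fun \<mu> n)" for n
  interpret L2_basis \<mu> e
    using hermite_basis[OF assms] unfolding e_def[abs_def] .
  let ?d = "\<lambda>n. (- \<i>) ^ n"
  have norm_d: "cmod (?d n) = 1" for n
    by (simp add: norm_power)
  have cnj_d: "(\<lambda>n. cnj (?d n)) = (\<lambda>n. \<i> ^ n)"
    by simp
  have span: "abs_aefun (gft_integral \<mu> \<sigma> f) = diag (\<lambda>n. \<sigma> ^ n) (abs_aefun f)"
    if "f \<in> hermite_span \<mu>" "\<sigma>\<^sup>2 = - 1" for f \<sigma>
    using that abs_aefun_gft_integral_span[of \<sigma>] by (auto simp: hermite_span_def e_def[abs_def])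
  have comb_eq: "comb a {..<N} = abs_aefun (\<lambda>x. \<Sum>n<N. a n * hermite_fun \<mu> n x)" for a N
    by (simp add: comb_def e_def abs_aefun_sum_scale)
  have comb_span: "(\<lambda>x. \<Sum>n<N. a n * hermite_fun \<mu> n x) \<in> hermite_span \<mu>" for a N
    by (auto simp: hermite_span_def)
  have "gft_extension \<mu> (diag ?d)"
    unfolding gft_extension_def using diag_continuous[of ?d] norm_d span[of _ "- \<i>"] by simp
  then have ext: "gft_extension \<mu> (gft \<mu>)"
    unfolding gft_def by (rule someI[of "gft_extension \<mu>"])
  \<comment> \<open>Two continuous maps that agree on the partial sums of the basis expansion agree at its limit.\<close>
  have gft_eq: "gft \<mu> X = diag ?d X" if X: "X \<in> L2 \<mu>" for X
  proof (rule Metric_space.limitin_metric_unique[OF L2_Metric_space])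
    have cont: "continuous_map (L2_topology \<mu>) (L2_topology \<mu>) (gft \<mu>)"
      and on_span: "\<And>f. f \<in> hermite_span \<mu> \<Longrightarrow> gft \<mu> (abs_aefun f) = diag ?d (abs_aefun f)"
      using ext span[of _ "- \<i>"] by (simp_all add: gft_extension_def)
    have "(gft \<mu> \<circ> (\<lambda>N. comb (coeff X) {..<N})) = (diag ?d \<circ> (\<lambda>N. comb (coeff X) {..<N}))"
      by (simp add: fun_eq_iff comb_eq on_span comb_span)
    then show "limitin (Metric_space.mtopology (L2 \<mu>) (\<lambda>X Y. L2_norm \<mu> (X - Y)))
        (diag ?d \<circ> (\<lambda>N. comb (coeff X) {..<N})) (gft \<mu> X) sequentially"
      using continuous_map_limit[OF cont limitin_basis_expansion[OF X]] by (simp add: L2_topology_def)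
    show "limitin (Metric_space.mtopology (L2 \<mu>) (\<lambda>X Y. L2_norm \<mu> (X - Y)))
        (diag ?d \<circ> (\<lambda>N. comb (coeff X) {..<N})) (diag ?d X) sequentially"
      using continuous_map_limit[OF diag_continuous[OF norm_d] limitin_basis_expansion[OF X]]
      by (simp add: L2_topology_def)
  qed simp
  note adj = L2_adjoint_diag[of ?d "gft \<mu>", OF norm_d gft_eq, unfolded cnj_d]
  have "range ?d = {1, -1, \<i>, -\<i>}"
  proof
    have "?d n \<in> {1, -1, \<i>, -\<i>}" for n
      by (induction n) auto
    then show "range ?d \<subseteq> {1, -1, \<i>, -\<i>}" by auto
    have "?d 0 = 1" "?d 1 = - \<i>" "?d 2 = - 1" "?d 3 = \<i>"
      by (simp_all add: power2_eq_square power3_eq_cube)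
    then show "{1, -1, \<i>, -\<i>} \<subseteq> range ?d"
      by (metis empty_subsetI insert_subset rangeI)
  qed
  then have eigenvalues: "L2_eigenvalues \<mu> (gft \<mu>) = {1, -1, \<i>, -\<i>}"
    using L2_eigenvalues_diag[of ?d "gft \<mu>", OF norm_d gft_eq] by simp
  have adjoint: "\<forall>X\<in>L2 \<mu>. L2_adjoint \<mu> (gft \<mu>) X \<in> L2 \<mu> \<and>
       (\<forall>Y\<in>L2 \<mu>. L2_inner \<mu> (gft \<mu> Y) X = L2_inner \<mu> Y (L2_adjoint \<mu> (gft \<mu>) X)) \<and>
       gft \<mu> (L2_adjoint \<mu> (gft \<mu>) X) = X \<and>
       L2_adjoint \<mu> (gft \<mu>) (gft \<mu> X) = X"
  proof
    fix X assume X: "X \<in> L2 \<mu>"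
    have "diag (\<lambda>n. \<i> ^ n) X \<in> L2 \<mu>" "diag ?d X \<in> L2 \<mu>"
      using X by (auto intro!: diag_in_L2 simp: norm_power)
    then show "L2_adjoint \<mu> (gft \<mu>) X \<in> L2 \<mu> \<and>
       (\<forall>Y\<in>L2 \<mu>. L2_inner \<mu> (gft \<mu> Y) X = L2_inner \<mu> Y (L2_adjoint \<mu> (gft \<mu>) X)) \<and>
       gft \<mu> (L2_adjoint \<mu> (gft \<mu>) X) = X \<and>
       L2_adjoint \<mu> (gft \<mu>) (gft \<mu> X) = X"
      using X diag_diag_cnj[of ?d, OF norm_d X] diag_inner_cnj[of ?d _ X, OF norm_d _ X]
      unfolding cnj_d by (simp add: adj gft_eq)
  qed
  have inverse: "\<forall>f\<in>hermite_span \<mu>. (\<forall>x. integrable lebesgue (gft_integrand \<mu> \<i> f x)) \<and>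
       L2_adjoint \<mu> (gft \<mu>) (abs_aefun f) = abs_aefun (gft_integral \<mu> \<i> f)"
  proof
    fix f assume f: "f \<in> hermite_span \<mu>"
    obtain c N where c: "f = (\<lambda>x. \<Sum>n<N. c n * hermite_fun \<mu> n x)"
      using f by (auto simp: hermite_span_def)
    then have "abs_aefun f \<in> L2 \<mu>"
      using comb_in_L2[of c "{..<N}"] by (simp add: comb_eq)
    then show "(\<forall>x. integrable lebesgue (gft_integrand \<mu> \<i> f x)) \<and>
       L2_adjoint \<mu> (gft \<mu>) (abs_aefun f) = abs_aefun (gft_integral \<mu> \<i> f)"
      using gft_hermite_span(1)[OF assms, of \<i> c N] span[OF f, of \<i>] by (simp add: adj c)
  qed
  have complete: "L2_complete_orthonormal \<mu> (\<lambda>n. abs_aefun (hermite_fun \<mu> n))"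
    using complete_orthonormal by (simp add: e_def[abs_def])
  have "L2_eigenvector \<mu> (gft \<mu>) (?d n) (abs_aefun (hermite_fun \<mu> n))" for n
    using L2_eigenvector_basis[of ?d "gft \<mu>" n, OF norm_d gft_eq] by (simp add: e_def)
  then have eigenvectors: "\<forall>n. \<exists>c. L2_eigenvector \<mu> (gft \<mu>) c (abs_aefun (hermite_fun \<mu> n))"
    by (intro allI exI)
  have unitary: "L2_unitary \<mu> (gft \<mu>)"
    by (rule L2_unitary_diag[of ?d "gft \<mu>", OF norm_d gft_eq])
  show ?thesis
    by (intro conjI ext unitary eigenvalues complete eigenvectors adjoint inverse)
qed

end
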